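(* Let $\alpha_g=\limsup_{q\to\infty}\alpha_g(q)/\sqrt q$. Then, as $g\to\infty$, $$\alpha_g=\sqrt g+O\left(g^{3/10}\right);$$ in particular $\lim_{g\to\infty}\alpha_g/\sqrt g=1$.
   Context: For a subset $A$ of a commutative group $G$, its representation function is $r(x)=\#\{(a_1,a_2): a_1,a_2\in A,\ a_1+a_2=x\}$ (ordered pairs). $A$ is a $g$-Sidon set if $r(x)\le g$ for all $x\in G$. For a positive integer $q$, $\alpha_g(q)$ is the maximum of $|A|$ over all $g$-Sidon sets $A\subseteq\mathbb{Z}_q=\mathbb{Z}/q\mathbb{Z}$. *)

theory Defs
  imports "HOL-Analysis.Analysis" "HOL-Algebra.Elementary_Groups" "HOL-Library.Landau_Symbols"
begin

definition reps :: "('a, 'b) monoid_scheme \<Rightarrow> 'a set \<Rightarrow> 'a \<Rightarrow> ('a \<times> 'a) set" where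
  "reps G A x = {(a, b). a \<in> A \<and> b \<in> A \<and> a \<otimes>\<^bsub>G\<^esub> b = x}"

(* Finiteness is required because card of an infinite set is 0; it holds automatically
   when A is finite. *)
definition Sidon :: "('a, 'b) monoid_scheme \<Rightarrow> nat \<Rightarrow> 'a set \<Rightarrow> bool" where
  "Sidon G g A \<longleftrightarrow> A \<subseteq> carrier G \<and>
     (\<forall>x \<in> carrier G. finite (reps G A x) \<and> card (reps G A x) \<le> g)"

(* integer_mod_group q is the additive group on {0..<int q} for q > 0.  It is the group of all
   integers for q = 0, where the Max below has no meaning; this value does not affect the
   limit superior over q. *)
definition max_Sidon :: "nat \<Rightarrow> nat \<Rightarrow> nat" where
  "max_Sidon g q = Max {card A | A. Sidon (integer_mod_group q) g A}"

definition alpha_ereal :: "nat \<Rightarrow> ereal" where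
  "alpha_ereal g = limsup (\<lambda>q. ereal (real (max_Sidon g q) / sqrt (real q)))"

(* real_of_ereal maps infinite values to 0; alpha_ereal_finite below shows that this case
   does not occur. *)
definition alpha :: "nat \<Rightarrow> real" where
  "alpha g = real_of_ereal (alpha_ereal g)"

lemma Sidon_card_bound:
  assumes q: "q > 0" and A: "Sidon (integer_mod_group q) g A"
  shows "finite A" and "(card A)\<^sup>2 \<le> g * q"
proof -
  let ?G = "integer_mod_group q"
  have car: "carrier ?G = {0..<int q}"
    using q by (simp add: carrier_integer_mod_group)
  have sub: "A \<subseteq> carrier ?G"
    using A by (simp add: Sidon_def)
  then show fin: "finite A"
    unfolding car using finite_subset by blast
  have "A \<times> A \<subseteq> (\<Union>x\<in>carrier ?G. reps ?G A x)"
    using sub q by (auto simp: reps_def car)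
  moreover have "finite (\<Union>x\<in>carrier ?G. reps ?G A x)"
    using A by (auto simp: car Sidon_def)
  ultimately have "card (A \<times> A) \<le> card (\<Union>x\<in>carrier ?G. reps ?G A x)"
    by (rule card_mono[rotated])
  also have "\<dots> \<le> (\<Sum>x\<in>carrier ?G. card (reps ?G A x))"
    by (rule card_UN_le) (simp add: car)
  also have "\<dots> \<le> (\<Sum>x\<in>carrier ?G. g)"
    by (rule sum_mono) (use A in \<open>auto simp: Sidon_def\<close>)
  also have "\<dots> = g * q"
    by (simp add: car)
  finally show "(card A)\<^sup>2 \<le> g * q"
    by (simp add: power2_eq_square card_cartesian_product)
qed

lemma max_Sidon_attained:
  assumes "q > 0"
  shows "finite {card A | A. Sidon (integer_mod_group q) g A}"
    and "\<exists>A. Sidon (integer_mod_group q) g A \<and> card A = max_Sidon g q"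
proof -
  let ?S = "{card A | A. Sidon (integer_mod_group q) g A}"
  have "?S \<subseteq> card ` Pow {0..<int q}"
    using assms by (auto simp: Sidon_def carrier_integer_mod_group)
  then show fin: "finite ?S"
    by (rule finite_subset) simp
  have "Sidon (integer_mod_group q) g {}"
    by (simp add: Sidon_def reps_def)
  then have "?S \<noteq> {}"
    by blast
  with fin have "Max ?S \<in> ?S"
    by (rule Max_in)
  then show "\<exists>A. Sidon (integer_mod_group q) g A \<and> card A = max_Sidon g q"
    by (auto simp: max_Sidon_def)
qed

lemma alpha_ereal_finite: "0 \<le> alpha_ereal g" "alpha_ereal g \<le> ereal (sqrt (real g))"
proof -
  show "0 \<le> alpha_ereal g"
    unfolding alpha_ereal_def by (rule le_Limsup) (auto simp: zero_ereal_def)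
  have "real (max_Sidon g q) / sqrt (real q) \<le> sqrt (real g)" if q: "q > 0" for q
  proof -
    obtain A where "Sidon (integer_mod_group q) g A" "card A = max_Sidon g q"
      using max_Sidon_attained(2)[OF q] by blast
    then have "(max_Sidon g q)\<^sup>2 \<le> g * q"
      using Sidon_card_bound(2)[OF q] by metis
    then have "(real (max_Sidon g q))\<^sup>2 \<le> real g * real q"
      by (metis of_nat_le_iff of_nat_mult of_nat_power)
    then have "real (max_Sidon g q) \<le> sqrt (real g * real q)"
      by (rule real_le_rsqrt)
    with q show ?thesis
      by (simp add: real_sqrt_mult field_simps)
  qed
  then show "alpha_ereal g \<le> ereal (sqrt (real g))"
    unfolding alpha_ereal_def
    by (intro Limsup_bounded) (auto intro!: eventually_sequentiallyI[of 1])
qed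

lemma ereal_alpha: "ereal (alpha g) = alpha_ereal g"
  using alpha_ereal_finite[of g] unfolding alpha_def by (cases "alpha_ereal g") auto

end

(* For a prime p and parameters t, d the points u(w) = t + 2 w . d, with w in the cube {0..<m}^3,
   index k = m^3 parabolas {(u x, u x^2)}, u = u(w), in Z_p^2.  The number of representations of (a, b) by
   the parabolas of u and v is at most 1 + chi(u v) chi((u + v) b - a^2).  As u + v only depends
   on s = v + w, the total is at most k^2 plus the sum over s of the absolute values of the
   correlations r(s) = sum of chi(u(w)) chi(u(s - w)).  The mean square of r(s) over the
   parameters splits into pairs w, w': if 2w - s and 2w' - s are not parallel, the sum over the
   parameters factors into Jacobi sums and is negligible; only O(k) pairs are parallel, because the
   cube has dimension three.  By Cauchy-Schwarz some parameters give a union of parabolas with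
   about k p elements and at most k^2 + O(k^(3/2)) representations of each point.

   Blowing up by a factor s turns a planar set into one in the cyclic group Z_(p^2 s), at the cost
   of a factor (s + 1) / s.  The choice k ~ g^(2/5), s ~ g^(1/5) balances the relative errors
   k^(-1/2) and 1/s.  The upper bound is the trivial one. *)

theory Submission
  imports Defs "HOL-Number_Theory.Number_Theory" "HOL-Real_Asymp.Real_Asymp"
begin

subsection \<open>Legendre symbol sums\<close>

locale odd_prime =
  fixes p :: nat
  assumes prime_p: "prime p" and p_gt_2: "2 < p"
begin

abbreviation R :: "int set" where "R \<equiv> {0..<int p}"

abbreviation chi :: "int \<Rightarrow> int" where "chi a \<equiv> Legendre a (int p)"

text \<open>Functions on Z_p are encoded as functions on the integers that respect reduction mod p,
  so that sums over \<open>R\<close> can be reindexed by affine maps.\<close>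

definition periodic :: "(int \<Rightarrow> 'a) \<Rightarrow> bool" where
  "periodic f \<longleftrightarrow> (\<forall>x. f (x mod int p) = f x)"

lemma prime_int_p: "prime (int p)"
  using prime_p by simp

lemma p_pos: "0 < int p"
  using p_gt_2 by simp

lemma mod_in_R: "x mod int p \<in> R"
  using p_pos by simp

lemma R_eq_if_dvd_diff:
  assumes "x \<in> R" "y \<in> R" "int p dvd x - y"
  shows "x = y"
  using assms by (auto simp flip: mod_eq_dvd_iff)

lemma chi_cong: "[a = b] (mod int p) \<Longrightarrow> chi a = chi b"
  by (simp add: Legendre_def QuadRes_def cong_def)

lemma chi_mod: "chi (x mod int p) = chi x"
  by (rule chi_cong) (simp add: cong_def)

lemma chi_values: "chi a \<in> {-1, 0, 1}"
  by (simp add: Legendre_def)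

lemma abs_chi_le: "\<bar>chi a\<bar> \<le> 1"
  by (simp add: Legendre_def)

lemma chi_eq_0_iff: "chi a = 0 \<longleftrightarrow> int p dvd a"
  by (simp add: Legendre_def cong_0_iff)

text \<open>By Euler's criterion both sides are congruent mod p, and they differ by at most 2, which
  is less than p.\<close>

lemma chi_mult: "chi (a * b) = chi a * chi b"
proof -
  let ?e = "(p - 1) div 2"
  have "[chi (a * b) = (a * b) ^ ?e] (mod int p)"
    using euler_criterion prime_p p_gt_2 by blast
  moreover have "[chi a * chi b = a ^ ?e * b ^ ?e] (mod int p)"
    using euler_criterion prime_p p_gt_2 by (intro cong_mult) blast+
  ultimately have "[chi (a * b) = chi a * chi b] (mod int p)"
    by (metis cong_sym cong_trans power_mult_distrib)
  then have d: "int p dvd chi (a * b) - chi a * chi b"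
    by (simp add: cong_iff_dvd_diff)
  have "\<bar>chi (a * b) - chi a * chi b\<bar> < int p"
    using chi_values[of "a * b"] chi_values[of a] chi_values[of b] p_gt_2 by auto
  with d show ?thesis
    using zdvd_not_zless[of "\<bar>chi (a * b) - chi a * chi b\<bar>" "int p"] by fastforce
qed

lemma chi_square_factor: "\<not> int p dvd c \<Longrightarrow> chi (c * a) * chi (c * b) = chi a * chi b"
proof -
  assume "\<not> int p dvd c"
  then have "chi c * chi c = 1"
    using chi_values[of c] chi_eq_0_iff[of c] by auto
  then show ?thesis
    by (simp add: chi_mult algebra_simps)
qed

lemma sum_affine:
  fixes f :: "int \<Rightarrow> int"
  assumes f: "periodic f" and a: "\<not> int p dvd a"
  shows "(\<Sum>x\<in>R. f (a * x + b)) = (\<Sum>x\<in>R. f x)"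
proof -
  let ?h = "\<lambda>x. (a * x + b) mod int p"
  have inj: "inj_on ?h R"
  proof (rule inj_onI)
    fix x y assume xy: "x \<in> R" "y \<in> R" "?h x = ?h y"
    then have "int p dvd a * (x - y)"
      by (simp add: mod_eq_dvd_iff algebra_simps)
    with a have "int p dvd x - y"
      using prime_dvd_mult_iff[OF prime_int_p] by blast
    with xy show "x = y"
      using R_eq_if_dvd_diff by blast
  qed
  have "?h ` R = R"
    by (rule endo_inj_surj) (use inj mod_in_R in auto)
  with inj have "(\<Sum>x\<in>R. f x) = (\<Sum>x\<in>R. f (?h x))"
    using sum.reindex[of ?h R f] by simp
  then show ?thesis
    using f by (simp add: periodic_def)
qed

lemma sum_translate:
  fixes f :: "int \<Rightarrow> int"
  assumes "periodic f"
  shows "(\<Sum>x\<in>R. f (x + b)) = (\<Sum>x\<in>R. f x)"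
  using sum_affine[OF assms, of 1 b] p_gt_2 by auto

text \<open>An affine map of the plane with invertible determinant permutes Z_p^2 (Cramer's rule
  gives injectivity), so the two arguments may be treated as independent variables.\<close>

lemma sum_linear_2:
  fixes f g :: "int \<Rightarrow> int"
  assumes f: "periodic f" and g: "periodic g" and det: "\<not> int p dvd a * d - b * c"
  shows "(\<Sum>x\<in>R. \<Sum>y\<in>R. f (a * x + b * y + e) * g (c * x + d * y + e')) = sum f R * sum g R"
proof -
  let ?h = "\<lambda>(x, y). ((a * x + b * y + e) mod int p, (c * x + d * y + e') mod int p)"
  have inj: "inj_on ?h (R \<times> R)"
  proof (rule inj_onI)
    fix z z' assume z: "z \<in> R \<times> R" "z' \<in> R \<times> R" "?h z = ?h z'"
    obtain x y x' y' where e: "z = (x, y)" "z' = (x', y')"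
      by (cases z, cases z') auto
    have 1: "int p dvd a * (x - x') + b * (y - y')" "int p dvd c * (x - x') + d * (y - y')"
      using z by (auto simp: e mod_eq_dvd_iff algebra_simps)
    have "int p dvd d * (a * (x - x') + b * (y - y')) - b * (c * (x - x') + d * (y - y'))"
      using 1 by (intro dvd_diff dvd_mult) auto
    then have "int p dvd (a * d - b * c) * (x - x')"
      by (simp add: algebra_simps)
    moreover have "int p dvd a * (c * (x - x') + d * (y - y')) - c * (a * (x - x') + b * (y - y'))"
      using 1 by (intro dvd_diff dvd_mult) auto
    then have "int p dvd (a * d - b * c) * (y - y')"
      by (simp add: algebra_simps)
    ultimately have "int p dvd x - x'" "int p dvd y - y'"
      using det prime_dvd_mult_iff[OF prime_int_p] by blast+
    with z show "z = z'"
      using R_eq_if_dvd_diff by (auto simp: e)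
  qed
  have surj: "?h ` (R \<times> R) = R \<times> R"
    by (rule endo_inj_surj) (use inj mod_in_R in auto)
  have "sum f R * sum g R = (\<Sum>z\<in>R \<times> R. f (fst z) * g (snd z))"
    by (simp add: sum_product sum.cartesian_product case_prod_unfold)
  also have "\<dots> = (\<Sum>z\<in>R \<times> R. f (fst (?h z)) * g (snd (?h z)))"
    using sum.reindex[OF inj, of "\<lambda>z. f (fst z) * g (snd z)"] surj by (simp add: o_def)
  also have "\<dots> = (\<Sum>(x, y)\<in>R \<times> R. f (a * x + b * y + e) * g (c * x + d * y + e'))"
    using f g by (intro sum.cong) (auto simp: periodic_def)
  finally show ?thesis
    by (simp add: sum.cartesian_product)
qed

text \<open>Without non-residues, squaring would be onto the finite set \<open>R\<close>, hence
  injective there; but 1 and p - 1 have the same square.\<close>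

lemma ex_chi_neg: "\<exists>c. chi c = -1"
proof (rule ccontr)
  assume neg: "\<not> ?thesis"
  let ?h = "\<lambda>x. x\<^sup>2 mod int p"
  have "R \<subseteq> ?h ` R"
  proof
    fix a assume a: "a \<in> R"
    show "a \<in> ?h ` R"
    proof (cases "a = 0")
      case True
      then show ?thesis using p_pos by (intro image_eqI[of _ _ 0]) auto
    next
      case False
      then have "\<not> int p dvd a"
        using a zdvd_not_zless by force
      then have "QuadRes (int p) a"
        using neg by (auto simp: Legendre_def cong_0_iff split: if_splits)
      then obtain y where "[y\<^sup>2 = a] (mod int p)"
        by (auto simp: QuadRes_def)
      then have "?h (y mod int p) = a"
        using a by (simp add: cong_def power_mod)
      then show ?thesis
        using mod_in_R by (metis image_eqI)
    qed
  qed
  then have "inj_on ?h R"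
    by (intro finite_surj_inj) auto
  moreover have "?h 1 = ?h (int p - 1)"
    by (simp add: mod_eq_dvd_iff power2_eq_square algebra_simps)
  moreover have "1 \<in> R" "int p - 1 \<in> R" "1 \<noteq> int p - 1"
    using p_gt_2 by auto
  ultimately show False
    by (meson inj_onD)
qed

lemma periodic_chi: "periodic chi"
  by (simp add: periodic_def chi_mod)

text \<open>Multiplying the variable by a non-residue permutes the terms and flips the sign of the
  sum.\<close>

lemma sum_chi: "(\<Sum>x\<in>R. chi x) = 0"
proof -
  obtain c where c: "chi c = -1"
    using ex_chi_neg by blast
  then have "\<not> int p dvd c"
    using chi_eq_0_iff[of c] by auto
  then have "(\<Sum>x\<in>R. chi x) = (\<Sum>x\<in>R. chi (c * x))"
    using sum_affine[OF periodic_chi, of c 0] by simp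
  also have "\<dots> = - (\<Sum>x\<in>R. chi x)"
    by (simp add: chi_mult c sum_negf)
  finally show ?thesis by simp
qed

section \<open>Jacobi sums of the quadratic character\<close>

definition jacobi :: "int \<Rightarrow> int" where
  "jacobi s = (\<Sum>x\<in>R. chi x * chi (s - x))"

lemma jacobi_0: "jacobi 0 = chi (-1) * (int p - 1)"
proof -
  have "jacobi 0 = (\<Sum>x\<in>R. chi (- 1) * (if x = 0 then 0 else 1))"
    unfolding jacobi_def
  proof (rule sum.cong)
    fix x assume x: "x \<in> R"
    show "chi x * chi (0 - x) = chi (- 1) * (if x = 0 then 0 else 1)"
    proof (cases "x = 0")
      case False
      then have "\<not> int p dvd x"
        using x zdvd_not_zless by force
      then have "chi (x * 1) * chi (x * -1) = chi 1 * chi (-1)"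
        by (rule chi_square_factor)
      moreover have "chi 1 = 1"
        by (smt (verit, ccfv_threshold) chi_eq_0_iff chi_mult mult_cancel_left1 mult_1 prime_int_p not_prime_unit)
      ultimately show ?thesis
        using False by simp
    qed (simp add: chi_eq_0_iff)
  qed simp
  also have "\<dots> = chi (-1) * (\<Sum>x\<in>R. if x = 0 then 0 else 1)"
    by (simp add: sum_distrib_left)
  also have "(\<Sum>x\<in>R. if x = 0 then 0 else 1) = int (card (R - {0}))"
  proof -
    have "(\<Sum>x\<in>R. if x = 0 then 0 else 1) = (\<Sum>x\<in>R - {0}. 1 :: int)"
      by (intro sum.mono_neutral_cong_right) auto
    then show ?thesis by simp
  qed
  also have "\<dots> = int p - 1"
    using p_gt_2 by (simp add: card_Diff_singleton of_nat_diff)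
  finally show ?thesis .
qed

lemma chi_mod_diff: "chi (s - x mod int p) = chi (s - x)"
  by (rule chi_cong) (simp add: cong_def mod_diff_right_eq)

lemma periodic_jacobi_summand: "periodic (\<lambda>x. chi x * chi (s - x))"
  by (simp add: periodic_def chi_mod chi_mod_diff)

text \<open>Substituting s x for x pulls a factor chi(s) out of each of the two symbols, and these
  cancel.\<close>

lemma jacobi_eq_1:
  assumes "\<not> int p dvd s"
  shows "jacobi s = jacobi 1"
proof -
  have "jacobi s = (\<Sum>x\<in>R. chi (s * x) * chi (s - s * x))"
    unfolding jacobi_def using sum_affine[OF periodic_jacobi_summand[of s] assms, of 0] by simp
  also have "\<dots> = jacobi 1"
    unfolding jacobi_def
    using chi_square_factor[OF assms, of x "1 - x" for x] by (simp add: right_diff_distrib)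
  finally show ?thesis .
qed

lemma jacobi_mod: "jacobi (s mod int p) = jacobi s"
proof -
  have "chi (s mod int p - x) = chi (s - x)" for x
    by (rule chi_cong) (simp add: cong_def mod_diff_left_eq)
  then show ?thesis
    by (simp add: jacobi_def)
qed

lemma sum_jacobi: "(\<Sum>s\<in>R. jacobi s) = 0"
proof -
  have "(\<Sum>s\<in>R. jacobi s) = (\<Sum>x\<in>R. chi x * (\<Sum>s\<in>R. chi (s - x)))"
    unfolding jacobi_def by (subst sum.swap) (simp add: sum_distrib_left)
  also have "\<dots> = 0"
    using sum_translate[OF periodic_chi, of "- x" for x] sum_chi by simp
  finally show ?thesis .
qed

text \<open>The sums over all s add up to 0 and those with s nonzero coincide, so
  \<open>jacobi 0\<close> determines their common value.\<close>

lemma jacobi_1: "jacobi 1 = - chi (-1)"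
proof -
  have "(\<Sum>s\<in>R. jacobi s) = jacobi 0 + (\<Sum>s\<in>R - {0}. jacobi s)"
    using p_pos by (subst sum.remove[of _ 0]) auto
  also have "(\<Sum>s\<in>R - {0}. jacobi s) = (\<Sum>s\<in>R - {0}. jacobi 1)"
    by (intro sum.cong refl jacobi_eq_1) (use zdvd_not_zless in force)
  also have "\<dots> = (int p - 1) * jacobi 1"
    using p_gt_2 by (simp add: card_Diff_singleton of_nat_diff)
  finally have "chi (-1) * (int p - 1) + (int p - 1) * jacobi 1 = 0"
    using sum_jacobi by (simp only: jacobi_0)
  then have "(int p - 1) * (chi (-1) + jacobi 1) = 0"
    by (simp add: distrib_left mult.commute)
  then show ?thesis
    using p_gt_2 by auto
qed

text \<open>The sum is (p - 1)^2 + (p - 1). Estimating each Jacobi sum by p would only give p^3; the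
  factor p saved here makes the non-parallel pairs negligible later.\<close>

lemma sum_jacobi_square: "(\<Sum>s\<in>R. (jacobi s)\<^sup>2) \<le> (int p)\<^sup>2"
proof -
  have c: "(chi (-1))\<^sup>2 \<le> 1"
    using chi_values[of "-1"] by auto
  have "(\<Sum>s\<in>R. (jacobi s)\<^sup>2) = (jacobi 0)\<^sup>2 + (\<Sum>s\<in>R - {0}. (jacobi s)\<^sup>2)"
    using p_pos by (subst sum.remove[of _ 0]) auto
  also have "(\<Sum>s\<in>R - {0}. (jacobi s)\<^sup>2) = (\<Sum>s\<in>R - {0}. (jacobi 1)\<^sup>2)"
    by (intro sum.cong refl arg_cong[where f = "\<lambda>x. x\<^sup>2"] jacobi_eq_1) (use zdvd_not_zless in force)
  also have "(jacobi 0)\<^sup>2 + \<dots> = (chi (-1))\<^sup>2 * (int p * (int p - 1))"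
    using p_gt_2
    by (simp add: card_Diff_singleton of_nat_diff jacobi_0 jacobi_1 power2_eq_square algebra_simps)
  also have "\<dots> \<le> 1 * (int p * (int p - 1))"
    using c p_gt_2 by (intro mult_right_mono) auto
  also have "\<dots> \<le> (int p)\<^sup>2"
    by (simp add: power2_eq_square algebra_simps)
  finally show ?thesis .
qed

end

subsection \<open>Parallel pairs of lattice vectors\<close>

fun dot :: "int \<times> int \<times> int \<Rightarrow> int \<times> int \<times> int \<Rightarrow> int" where
  "dot (a, b, c) (x, y, z) = a * x + b * y + c * z"

lemma dot_add_left: "dot (v + w) d = dot v d + dot w d"
  by (cases v; cases w; cases d) (simp add: algebra_simps)

lemma dot_diff_left: "dot (v - w) d = dot v d - dot w d"
  by (cases v; cases w; cases d) (simp add: algebra_simps)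

text \<open>Vanishing of the cross product over the integers; the zero vector is parallel to every
  vector.\<close>

fun parallel :: "int \<times> int \<times> int \<Rightarrow> int \<times> int \<times> int \<Rightarrow> bool" where
  "parallel (a, b, c) (x, y, z) \<longleftrightarrow> a * y = b * x \<and> b * z = c * y \<and> a * z = c * x"

definition cube :: "int set \<Rightarrow> (int \<times> int \<times> int) set" where
  "cube S = S \<times> S \<times> S"

lemma finite_cube: "finite S \<Longrightarrow> finite (cube S)"
  by (simp add: cube_def)

lemma card_cube: "card (cube S) = card S ^ 3"
  by (simp add: cube_def card_cartesian_product power3_eq_cube)

fun scale3 :: "int \<Rightarrow> int \<times> int \<times> int \<Rightarrow> int \<times> int \<times> int" where
  "scale3 k (x, y, z) = (k * x, k * y, k * z)"

text \<open>Dividing by the gcd \<open>a\<close> of the coordinates leaves a primitive vector, and Bezout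
  coefficients for it produce the integer \<open>b\<close>.\<close>

lemma parallel_multiples:
  assumes "parallel n n'" "n \<noteq> (0, 0, 0)"
  obtains a b e where "a > 0" "n = scale3 a e" "n' = scale3 b e"
proof -
  obtain n1 n2 n3 where n: "n = (n1, n2, n3)" by (cases n)
  obtain m1 m2 m3 where n': "n' = (m1, m2, m3)" by (cases n')
  define a where "a = gcd n1 (gcd n2 n3)"
  have "a \<noteq> 0" using assms(2) n by (simp add: a_def)
  moreover have "a \<ge> 0" by (simp add: a_def)
  ultimately have a: "a > 0" by simp
  obtain e1 e2 e3 where e: "n1 = a * e1" "n2 = a * e2" "n3 = a * e3"
  proof -
    have "a dvd n1" "a dvd n2" "a dvd n3"
      unfolding a_def by (simp_all add: gcd_dvdI2)
    then show thesis using that by (auto elim!: dvdE)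
  qed
  obtain x y where xy: "x * n2 + y * n3 = gcd n2 n3"
    using bezout_int by blast
  obtain u v where "u * n1 + v * gcd n2 n3 = a"
    unfolding a_def using bezout_int by blast
  then have "u * n1 + (v * x) * n2 + (v * y) * n3 = a"
    by (simp flip: xy add: algebra_simps)
  then have "a * (u * e1 + (v * x) * e2 + (v * y) * e3) = a * 1"
    by (simp add: e algebra_simps)
  then have one: "u * e1 + (v * x) * e2 + (v * y) * e3 = 1"
    using a by simp
  have par: "e1 * m2 = e2 * m1" "e2 * m3 = e3 * m2" "e1 * m3 = e3 * m1"
    using assms(1) a by (simp_all add: n n' e algebra_simps)
  define b where "b = u * m1 + (v * x) * m2 + (v * y) * m3"
  have "b * e1 = u * m1 * e1 + (v * x) * (e1 * m2) + (v * y) * (e1 * m3)"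
    by (simp add: b_def algebra_simps)
  also have "\<dots> = m1 * (u * e1 + (v * x) * e2 + (v * y) * e3)"
    unfolding par by (simp add: algebra_simps)
  finally have 1: "b * e1 = m1" by (simp add: one)
  have "b * e2 = u * (e2 * m1) + (v * x) * m2 * e2 + (v * y) * (e2 * m3)"
    by (simp add: b_def algebra_simps)
  also have "\<dots> = m2 * (u * e1 + (v * x) * e2 + (v * y) * e3)"
    unfolding par(1)[symmetric] par(2) by (simp add: algebra_simps)
  finally have 2: "b * e2 = m2" by (simp add: one)
  have "b * e3 = u * (e3 * m1) + (v * x) * (e3 * m2) + (v * y) * m3 * e3"
    by (simp add: b_def algebra_simps)
  also have "\<dots> = m3 * (u * e1 + (v * x) * e2 + (v * y) * e3)"
    unfolding par(2,3)[symmetric] by (simp add: algebra_simps)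
  finally have 3: "b * e3 = m3" by (simp add: one)
  have "n' = scale3 b (e1, e2, e3)"
    by (simp add: n' 1 2 3)
  moreover have "n = scale3 a (e1, e2, e3)"
    by (simp add: n e)
  ultimately show thesis
    using that a by blast
qed

text \<open>Telescoping: 1 / (M + 1)^2 is at most 1 / M - 1 / (M + 1).\<close>

lemma sum_inverse_squares_le: "(\<Sum>a=1..M. 1 / (real a)\<^sup>2) \<le> 2"
proof -
  have "(\<Sum>a=1..M. 1 / (real a)\<^sup>2) \<le> 2 - 1 / real M" if "M \<ge> 1"
    using that
  proof (induction M rule: dec_induct)
    case (step M)
    have "1 / (real (Suc M))\<^sup>2 \<le> 1 / real M - 1 / real (Suc M)"
      using step(1) by (simp add: divide_simps power2_eq_square)
    with step show ?case by simp
  qed simp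
  then show ?thesis
    by (cases "M \<ge> 1") (auto intro: order_trans)
qed

text \<open>Only pairs whose first entry has the larger coefficient are listed, with that
  coefficient positive; \<open>prod.swap\<close> supplies the others. The multiplier a forces the
  common vector e into a cube of radius M / a.\<close>

definition multiples_of_common :: "nat \<Rightarrow> ((int \<times> int \<times> int) \<times> (int \<times> int \<times> int)) set" where
  "multiples_of_common M = (\<lambda>(a, b, e). (scale3 (int a) e, scale3 b e)) `
     (SIGMA a:{1..M}. {- int a..int a} \<times> cube {- int (M div a)..int (M div a)})"

text \<open>For each a there are at most 3 a choices of b and (3 M / a)^3 choices of e, hence 81 M^3
  / a^2 in all. Dimension three makes this summable over a without a logarithm.\<close>

lemma card_multiples_of_common:
  "finite (multiples_of_common M)" "card (multiples_of_common M) \<le> 162 * M ^ 3"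
proof -
  let ?S = "SIGMA a:{1..M}. {- int a..int a} \<times> cube {- int (M div a)..int (M div a)}"
  have fin: "finite ?S"
    by (intro finite_SigmaI finite_cartesian_product finite_cube) auto
  then show "finite (multiples_of_common M)"
    by (simp add: multiples_of_common_def)
  have "card (multiples_of_common M) \<le> card ?S"
    unfolding multiples_of_common_def by (rule card_image_le[OF fin])
  also have "card ?S = (\<Sum>a=1..M. (2 * a + 1) * (2 * (M div a) + 1) ^ 3)"
    by (subst card_SigmaI)
       (auto simp: finite_cube card_cartesian_product card_cube nat_add_distrib nat_mult_distrib
             intro!: sum.cong)
  finally have "real (card (multiples_of_common M))
      \<le> real (\<Sum>a=1..M. (2 * a + 1) * (2 * (M div a) + 1) ^ 3)"
    by (simp only: of_nat_le_iff)
  also have "\<dots> = (\<Sum>a=1..M. real ((2 * a + 1) * (2 * (M div a) + 1) ^ 3))"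
    by (rule of_nat_sum)
  also have "\<dots> \<le> (\<Sum>a=1..M. 81 * real M ^ 3 * (1 / (real a)\<^sup>2))"
  proof (rule sum_mono)
    fix a assume a: "a \<in> {1..M}"
    have "real (M div a) \<le> real M / real a"
      by (rule of_nat_div_le_of_nat)
    moreover have "1 \<le> real M / real a"
      using a by simp
    ultimately have "2 * real (M div a) + 1 \<le> 3 * (real M / real a)"
      by linarith
    then have "(2 * real (M div a) + 1) ^ 3 \<le> (3 * (real M / real a)) ^ 3"
      by (intro power_mono) auto
    then have "(2 * real a + 1) * (2 * real (M div a) + 1) ^ 3
        \<le> (3 * real a) * (3 * (real M / real a)) ^ 3"
      using a by (intro mult_mono) auto
    also have "\<dots> = 81 * real M ^ 3 * (1 / (real a)\<^sup>2)"
      using a by (simp add: power3_eq_cube power2_eq_square)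
    finally show "real ((2 * a + 1) * (2 * (M div a) + 1) ^ 3) \<le> \<dots>"
      by (simp add: algebra_simps)
  qed
  also have "\<dots> = 81 * real M ^ 3 * (\<Sum>a=1..M. 1 / (real a)\<^sup>2)"
    by (simp add: sum_distrib_left)
  also have "\<dots> \<le> 81 * real M ^ 3 * 2"
    by (intro mult_left_mono sum_inverse_squares_le) auto
  finally have "real (card (multiples_of_common M)) \<le> real (162 * M ^ 3)"
    by simp
  then show "card (multiples_of_common M) \<le> 162 * M ^ 3"
    by (simp only: of_nat_le_iff)
qed

lemma scale3_mem_multiples:
  assumes "scale3 a e \<in> cube {- int M..int M}" "a > 0" "\<bar>b\<bar> \<le> a" "scale3 a e \<noteq> (0, 0, 0)"
  shows "(scale3 a e, scale3 b e) \<in> multiples_of_common M"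
proof -
  obtain x y z where e: "e = (x, y, z)" by (cases e)
  have *: "\<bar>x\<bar> \<le> int (M div nat a)" if "\<bar>a * x\<bar> \<le> int M" for x
  proof -
    have "\<bar>x\<bar> * a \<le> int M" using that assms(2) by (simp add: abs_mult mult.commute)
    then have "\<bar>x\<bar> \<le> int M div a"
      using assms(2) zdiv_mono1[of "\<bar>x\<bar> * a" "int M" a] by simp
    then show ?thesis using assms(2) by (simp add: zdiv_int)
  qed
  have b: "\<bar>a * x\<bar> \<le> int M" "\<bar>a * y\<bar> \<le> int M" "\<bar>a * z\<bar> \<le> int M"
    using assms(1) by (auto simp: e cube_def)
  \<comment> \<open>Some coordinate of e is a nonzero integer, and a times it stays within
    M.\<close>
  have "a \<le> int M"
  proof -
    obtain w where w: "w \<noteq> 0" "\<bar>a * w\<bar> \<le> int M"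
      using assms(4) b by (auto simp: e)
    then have "a * 1 \<le> a * \<bar>w\<bar>" using assms(2) by (intro mult_left_mono) auto
    also have "a * \<bar>w\<bar> \<le> int M" using w(2) assms(2) by (simp add: abs_mult)
    finally show ?thesis by simp
  qed
  then have "(nat a, b, e) \<in> (SIGMA a:{1..M}. {- int a..int a} \<times> cube {- int (M div a)..int (M div a)})"
    using *[OF b(1)] *[OF b(2)] *[OF b(3)] assms(2,3) by (auto simp: e cube_def)
  then show ?thesis
    unfolding multiples_of_common_def
    by (rule rev_image_eqI) (use assms(2) in simp)
qed

text \<open>Two parallel vectors are multiples of a common one. Sorting by the size of the two
  coefficients puts the pair or its swap into \<open>multiples_of_common M\<close>, which doubles
  162 to 324.\<close>

lemma card_parallel_pairs:
  assumes "M \<ge> 1"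
  defines "P \<equiv> {(n, n'). n \<in> cube {- int M..int M} \<and> n' \<in> cube {- int M..int M} \<and> parallel n n'}"
  shows "finite P" "card P \<le> 324 * M ^ 3"
proof -
  let ?C = "multiples_of_common M"
  have zero: "((0, 0, 0), (0, 0, 0)) \<in> ?C"
    unfolding multiples_of_common_def
    by (rule image_eqI[of _ _ "(1, 0, (0, 0, 0))"]) (use assms(1) in \<open>auto simp: cube_def\<close>)
  have "P \<subseteq> ?C \<union> prod.swap ` ?C"
  proof
    fix z assume z: "z \<in> P"
    obtain n n' where nn: "z = (n, n')" by (cases z)
    have n: "n \<in> cube {- int M..int M}" "n' \<in> cube {- int M..int M}" "parallel n n'"
      using z by (auto simp: P_def nn)
    show "z \<in> ?C \<union> prod.swap ` ?C"
    proof (cases "n = (0, 0, 0)")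
      case True
      show ?thesis
      proof (cases "n' = (0, 0, 0)")
        case True
        then show ?thesis using zero \<open>n = (0, 0, 0)\<close> nn by simp
      next
        case False
        \<comment> \<open>With n = 0, the decomposition is applied to n' paired with itself, and n
          becomes the zero multiple of the resulting vector.\<close>
        have "parallel n' n'" by (cases n') simp
        with False obtain a e where a: "a > 0" "n' = scale3 a e"
          using parallel_multiples by blast
        moreover have "n = scale3 0 e" using True by (cases e) simp
        ultimately have "(n', n) \<in> ?C"
          using scale3_mem_multiples[of a e M 0] n False by simp
        then show ?thesis using nn by force
      qed
    next
      case False
      then obtain a b e where e: "a > 0" "n = scale3 a e" "n' = scale3 b e"
        using parallel_multiples n(3) by blast
      show ?thesis
      proof (cases "\<bar>b\<bar> \<le> a")
        case True
        then show ?thesis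
          using scale3_mem_multiples[of a e M b] n False e nn by simp
      next
        case ba: False
        \<comment> \<open>The sign of b is moved into the common vector, so that the larger
          coefficient becomes positive.\<close>
        define e' where "e' = scale3 (sgn b) e"
        have "\<bar>b\<bar> * sgn b = b" "sgn b * sgn b = 1" "b \<noteq> 0"
          using ba e(1) by (auto simp: sgn_if abs_if)
        then have e': "n' = scale3 \<bar>b\<bar> e'" "n = scale3 (a * sgn b) e'" "\<bar>a * sgn b\<bar> = a"
          using e by (cases e; simp add: e'_def flip: mult.assoc; simp add: abs_mult)+
        have "n' \<noteq> (0, 0, 0)"
          using False e(2,3) \<open>b \<noteq> 0\<close> by (cases e) auto
        then have "(n', n) \<in> ?C"
          using scale3_mem_multiples[of "\<bar>b\<bar>" e' M "a * sgn b"] n e' ba e(1) by simp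
        then show ?thesis using nn by force
      qed
    qed
  qed
  moreover have fin: "finite (?C \<union> prod.swap ` ?C)"
    by (simp add: card_multiples_of_common(1))
  ultimately show "finite P"
    by (rule finite_subset)
  have "card P \<le> card (?C \<union> prod.swap ` ?C)"
    by (rule card_mono) fact+
  also have "\<dots> \<le> card ?C + card (prod.swap ` ?C)"
    by (rule card_Un_le)
  also have "\<dots> \<le> 162 * M ^ 3 + 162 * M ^ 3"
    using card_multiples_of_common[of M] card_image_le[of ?C prod.swap] by simp
  finally show "card P \<le> 324 * M ^ 3" by simp
qed

subsection \<open>Mean square of the correlations\<close>

definition index :: "nat \<Rightarrow> (int \<times> int \<times> int) set" where
  "index m = cube {0..<int m}"

definition splits :: "nat \<Rightarrow> int \<times> int \<times> int \<Rightarrow> (int \<times> int \<times> int) set" where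
  "splits m s = {w \<in> index m. s - w \<in> index m}"

text \<open>Coordinates of a sum of two indices reach only 2 m - 2; the extra value has no splits
  and makes the size exactly 8 m^3.\<close>

definition index_sums :: "nat \<Rightarrow> (int \<times> int \<times> int) set" where
  "index_sums m = cube {0..<2 * int m}"

lemma finite_index: "finite (index m)"
  by (simp add: index_def finite_cube)

lemma card_index: "card (index m) = m ^ 3"
  by (simp add: index_def card_cube)

lemma finite_splits: "finite (splits m s)"
  by (simp add: splits_def finite_index)

lemma card_splits: "card (splits m s) \<le> m ^ 3"
  using card_mono[OF finite_index, of "splits m s" m] by (auto simp: splits_def card_index)

lemma finite_index_sums: "finite (index_sums m)"
  by (simp add: index_sums_def finite_cube)

lemma card_index_sums: "card (index_sums m) = 8 * m ^ 3"
  by (simp add: index_sums_def card_cube nat_mult_distrib power_mult_distrib)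

text \<open>The vector 2 w - s determines w, and being a difference of two indices it lies in the
  cube of radius m, so the count of parallel lattice vectors applies.\<close>

lemma card_parallel_splits:
  assumes "m \<ge> 1"
  defines "n \<equiv> \<lambda>s w. w - (s - w)"
  shows "card {(v, w). v \<in> splits m s \<and> w \<in> splits m s \<and> parallel (n s v) (n s w)} \<le> 324 * m ^ 3"
proof -
  let ?P = "{(n, n'). n \<in> cube {- int m..int m} \<and> n' \<in> cube {- int m..int m} \<and> parallel n n'}"
  let ?Q = "{(v, w). v \<in> splits m s \<and> w \<in> splits m s \<and> parallel (n s v) (n s w)}"
  have inj: "inj (n s)"
    by (rule injI) (auto simp: n_def prod_eq_iff)
  have mem: "n s w \<in> cube {- int m..int m}" if "w \<in> splits m s" for w
    using that by (cases w; cases s) (auto simp: n_def splits_def index_def cube_def)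
  have "card ?Q \<le> card ?P"
  proof (rule card_inj_on_le)
    show "inj_on (map_prod (n s) (n s)) ?Q"
      using inj by (auto simp: inj_on_def inj_def)
    show "map_prod (n s) (n s) ` ?Q \<subseteq> ?P"
      using mem by auto
    show "finite ?P"
      using card_parallel_pairs(1)[OF assms(1)] .
  qed
  also have "\<dots> \<le> 324 * m ^ 3"
    using card_parallel_pairs(2)[OF assms(1)] .
  finally show ?thesis .
qed

text \<open>A nonzero minor of absolute value at most 2 M^2 stays nonzero mod q. This transfers
  non-parallelism from the integers to Z_p.\<close>

lemma minor_not_dvd:
  fixes a b c d :: int
  assumes "\<bar>a\<bar> \<le> M" "\<bar>b\<bar> \<le> M" "\<bar>c\<bar> \<le> M" "\<bar>d\<bar> \<le> M" "2 * M\<^sup>2 < q" "a * d \<noteq> b * c"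
  shows "\<not> q dvd a * d - b * c"
proof
  assume "q dvd a * d - b * c"
  then have "\<bar>q\<bar> \<le> \<bar>a * d - b * c\<bar>"
    using assms(6) by (intro dvd_imp_le_int) auto
  moreover have "\<bar>a * d\<bar> \<le> M * M" "\<bar>b * c\<bar> \<le> M * M"
    using assms(1-4) by (auto simp: abs_mult intro!: mult_mono)
  ultimately show False
    using assms(5) by (simp add: power2_eq_square)
qed

context odd_prime
begin

section \<open>Averaging over the direction d\<close>

definition directions :: "(int \<times> int \<times> int) set" where
  "directions = cube R"

lemma card_directions: "card directions = p ^ 3"
  by (simp add: directions_def card_cube)

lemma sum_directions: "(\<Sum>d\<in>directions. f d) = (\<Sum>x\<in>R. \<Sum>y\<in>R. \<Sum>z\<in>R. f (x, y, z))"
  by (simp add: directions_def cube_def sum.cartesian_product case_prod_unfold)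

text \<open>Some 2 by 2 minor of n, n' is invertible mod p. Summing over its two coordinates
  separates f from g, and the third coordinate contributes the factor p.\<close>

lemma sum_dot_pair:
  fixes f g :: "int \<Rightarrow> int"
  assumes f: "periodic f" and g: "periodic g" and npar: "\<not> parallel n n'"
    and n: "n \<in> cube {-M..M}" "n' \<in> cube {-M..M}" and M: "2 * M\<^sup>2 < int p"
  shows "(\<Sum>d\<in>directions. f (dot n d) * g (dot n' d)) = int p * (sum f R * sum g R)"
proof -
  obtain a b c where n1: "n = (a, b, c)" by (cases n)
  obtain a' b' c' where n2: "n' = (a', b', c')" by (cases n')
  have le: "\<bar>a\<bar> \<le> M" "\<bar>b\<bar> \<le> M" "\<bar>c\<bar> \<le> M" "\<bar>a'\<bar> \<le> M" "\<bar>b'\<bar> \<le> M" "\<bar>c'\<bar> \<le> M"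
    using n by (auto simp: n1 n2 cube_def)
  have S: "(\<Sum>d\<in>directions. f (dot n d) * g (dot n' d)) =
      (\<Sum>x\<in>R. \<Sum>y\<in>R. \<Sum>z\<in>R. f (a * x + b * y + c * z) * g (a' * x + b' * y + c' * z))"
    by (simp add: sum_directions n1 n2)
  have "a * b' \<noteq> b * a' \<or> b * c' \<noteq> c * b' \<or> a * c' \<noteq> c * a'"
    using npar by (simp add: n1 n2)
  then consider "a * b' \<noteq> b * a'" | "b * c' \<noteq> c * b'" | "a * c' \<noteq> c * a'" by blast
  then show ?thesis
  proof cases
    case 1
    then have nd: "\<not> int p dvd a * b' - b * a'"
      using le M by (intro minor_not_dvd[where M = M]) auto
    have "(\<Sum>x\<in>R. \<Sum>y\<in>R. \<Sum>z\<in>R. f (a * x + b * y + c * z) * g (a' * x + b' * y + c' * z))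
       = (\<Sum>z\<in>R. \<Sum>x\<in>R. \<Sum>y\<in>R. f (a * x + b * y + c * z) * g (a' * x + b' * y + c' * z))"
      by (subst (2) sum.swap, subst sum.swap) (rule refl)
    then show ?thesis
      by (simp add: S sum_linear_2[OF f g nd])
  next
    case 2
    then have nd: "\<not> int p dvd b * c' - c * b'"
      using le M by (intro minor_not_dvd[where M = M]) auto
    show ?thesis
      using sum_linear_2[OF f g nd, of "a * x" "a' * x" for x] by (simp add: S ac_simps)
  next
    case 3
    then have nd: "\<not> int p dvd a * c' - c * a'"
      using le M by (intro minor_not_dvd[where M = M]) auto
    have "(\<Sum>x\<in>R. \<Sum>y\<in>R. \<Sum>z\<in>R. f (a * x + b * y + c * z) * g (a' * x + b' * y + c' * z))
       = (\<Sum>y\<in>R. \<Sum>x\<in>R. \<Sum>z\<in>R. f (a * x + b * y + c * z) * g (a' * x + b' * y + c' * z))"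
      by (rule sum.swap)
    then show ?thesis
      using sum_linear_2[OF f g nd, of "b * y" "b' * y" for y] by (simp add: S ac_simps)
  qed
qed

text \<open>The factor 2 places the points of w and s - w symmetrically about
  \<open>t + dot s d\<close>, at offset \<open>dot (2 w - s) d\<close>, without dividing by
  2.\<close>

definition pt :: "int \<Rightarrow> int \<times> int \<times> int \<Rightarrow> int \<times> int \<times> int \<Rightarrow> int" where
  "pt t d w = t + 2 * dot w d"

definition corr :: "nat \<Rightarrow> int \<Rightarrow> int \<times> int \<times> int \<Rightarrow> int \<times> int \<times> int \<Rightarrow> int" where
  "corr m t d s = (\<Sum>w\<in>splits m s. chi (pt t d w) * chi (pt t d (s - w)))"

definition bump :: "int \<Rightarrow> int \<Rightarrow> int" where
  "bump c y = chi (c + y) * chi (c - y)"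

lemma periodic_bump: "periodic (bump c)"
proof -
  have "chi (c + x mod int p) = chi (c + x)" for x
    by (rule chi_cong) (simp add: cong_def mod_add_right_eq)
  then show ?thesis
    by (simp add: periodic_def bump_def chi_mod_diff)
qed

lemma bump_mod: "bump (c mod int p) y = bump c y"
proof -
  have "chi (c mod int p + y) = chi (c + y)" "chi (c mod int p - y) = chi (c - y)"
    by (rule chi_cong, simp add: cong_def mod_add_left_eq mod_diff_left_eq)+
  then show ?thesis
    by (simp add: bump_def)
qed

lemma abs_bump_le: "\<bar>bump c y\<bar> \<le> 1"
  using abs_chi_le[of "c + y"] abs_chi_le[of "c - y"] by (simp add: bump_def abs_mult mult_le_one)

text \<open>Translating y by c turns the symmetric product into chi(x) chi(2 c - x).\<close>

lemma sum_bump: "(\<Sum>y\<in>R. bump c y) = jacobi (2 * c)"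
proof -
  have "(\<Sum>y\<in>R. bump c y) = (\<Sum>x\<in>R. bump c (x - c))"
    using sum_translate[OF periodic_bump, of c "- c"] by simp
  then show ?thesis
    by (simp add: jacobi_def bump_def algebra_simps)
qed

lemma sum_square_sum_bump: "(\<Sum>c\<in>R. (\<Sum>y\<in>R. bump c y)\<^sup>2) \<le> (int p)\<^sup>2"
proof -
  have p2: "\<not> int p dvd 2"
    using p_gt_2 zdvd_not_zless[of 2 "int p"] by simp
  have per: "periodic (\<lambda>c. (jacobi c)\<^sup>2)"
    by (simp add: periodic_def jacobi_mod)
  have "(\<Sum>c\<in>R. (\<Sum>y\<in>R. bump c y)\<^sup>2) = (\<Sum>c\<in>R. (jacobi c)\<^sup>2)"
    using sum_affine[OF per p2, of 0] by (simp add: sum_bump)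
  then show ?thesis
    using sum_jacobi_square by simp
qed

lemma corr_summand: "chi (pt t d w) * chi (pt t d (s - w)) = bump (t + dot s d) (dot (w - (s - w)) d)"
proof -
  have "pt t d w = t + dot s d + dot (w - (s - w)) d"
       "pt t d (s - w) = t + dot s d - dot (w - (s - w)) d"
    by (simp_all add: pt_def dot_diff_left)
  then show ?thesis
    by (simp add: bump_def)
qed

text \<open>For each fixed d, translating t by \<open>dot s d\<close> removes the centre's
  dependence on d, so that d enters only through the two offsets.\<close>

lemma sum_bump_pair:
  "(\<Sum>t\<in>R. \<Sum>d\<in>directions. bump (t + dot s d) (dot n d) * bump (t + dot s d) (dot n' d)) =
   (\<Sum>t\<in>R. \<Sum>d\<in>directions. bump t (dot n d) * bump t (dot n' d))"
proof -
  have per: "periodic (\<lambda>t. bump t x * bump t y)" for x y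
    by (simp add: periodic_def bump_mod)
  show ?thesis
    by (subst (1 2) sum.swap) (simp add: sum_translate[OF per])
qed

text \<open>A parallel pair is bounded trivially by the p^4 parameters. Otherwise, for each t, the
  sum over d is p times the square of a Jacobi sum, and the mean square of these leaves p *
  p^2.\<close>

lemma sum_bump_pair_le:
  assumes "n \<in> cube {-M..M}" "n' \<in> cube {-M..M}" "2 * M\<^sup>2 < int p"
  shows "(\<Sum>t\<in>R. \<Sum>d\<in>directions. bump t (dot n d) * bump t (dot n' d))
    \<le> (if parallel n n' then int p ^ 4 else 0) + int p ^ 3"
proof (cases "parallel n n'")
  case True
  have "(\<Sum>t\<in>R. \<Sum>d\<in>directions. bump t (dot n d) * bump t (dot n' d)) \<le> (\<Sum>t\<in>R. \<Sum>d\<in>directions. 1)"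
  proof (intro sum_mono)
    fix t d
    have "bump t (dot n d) * bump t (dot n' d) \<le> \<bar>bump t (dot n d)\<bar> * \<bar>bump t (dot n' d)\<bar>"
      by (simp flip: abs_mult)
    also have "\<dots> \<le> 1"
      by (intro mult_le_one abs_bump_le abs_ge_zero)
    finally show "bump t (dot n d) * bump t (dot n' d) \<le> 1" .
  qed
  also have "\<dots> = int p ^ 4"
    by (simp add: card_directions power_numeral_reduce)
  also have "\<dots> \<le> int p ^ 4 + int p ^ 3"
    by simp
  finally show ?thesis
    using True by simp
next
  case False
  have "(\<Sum>t\<in>R. \<Sum>d\<in>directions. bump t (dot n d) * bump t (dot n' d)) = int p * (\<Sum>t\<in>R. (\<Sum>y\<in>R. bump t y)\<^sup>2)"
    by (simp add: sum_dot_pair[OF periodic_bump periodic_bump False assms] power2_eq_square sum_distrib_left)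
  also have "\<dots> \<le> int p * (int p)\<^sup>2"
    by (intro mult_left_mono sum_square_sum_bump) simp
  finally show ?thesis
    using False by (simp add: power2_eq_square power3_eq_cube)
qed

text \<open>Squaring \<open>corr\<close> gives a sum over pairs of splits: at most 324 m^3 parallel
  pairs cost p^4 each, and all of the at most m^6 pairs cost a further p^3.\<close>

lemma sum_corr_square_le:
  assumes "m \<ge> 1" "2 * m\<^sup>2 < p"
  shows "(\<Sum>t\<in>R. \<Sum>d\<in>directions. (corr m t d s)\<^sup>2) \<le> 324 * int m ^ 3 * int p ^ 4 + int m ^ 6 * int p ^ 3"
proof -
  let ?n = "\<lambda>w. w - (s - w)" and ?W = "splits m s"
  let ?g = "\<lambda>t d w. bump (t + dot s d) (dot (?n w) d)"
  have mem: "?n w \<in> cube {- int m..int m}" if "w \<in> ?W" for w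
    using that by (cases w; cases s) (auto simp: splits_def index_def cube_def)
  have M: "2 * (int m)\<^sup>2 < int p"
    using assms(2) of_nat_less_iff[of "2 * m\<^sup>2" p, where 'a = int] by simp
  have "(\<Sum>t\<in>R. \<Sum>d\<in>directions. (corr m t d s)\<^sup>2)
      = (\<Sum>t\<in>R. \<Sum>d\<in>directions. \<Sum>z\<in>?W \<times> ?W. ?g t d (fst z) * ?g t d (snd z))"
    by (simp add: corr_def corr_summand power2_eq_square sum_product sum.cartesian_product case_prod_unfold)
  also have "\<dots> = (\<Sum>t\<in>R. \<Sum>z\<in>?W \<times> ?W. \<Sum>d\<in>directions. ?g t d (fst z) * ?g t d (snd z))"
    by (intro sum.cong refl sum.swap)
  also have "\<dots> = (\<Sum>z\<in>?W \<times> ?W. \<Sum>t\<in>R. \<Sum>d\<in>directions. ?g t d (fst z) * ?g t d (snd z))"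
    by (rule sum.swap)
  also have "\<dots> \<le> (\<Sum>z\<in>?W \<times> ?W. (if parallel (?n (fst z)) (?n (snd z)) then int p ^ 4 else 0) + int p ^ 3)"
    unfolding sum_bump_pair
  proof (rule sum_mono)
    fix z assume z: "z \<in> ?W \<times> ?W"
    then have "fst z \<in> ?W" "snd z \<in> ?W" by auto
    then show "(\<Sum>t\<in>R. \<Sum>d\<in>directions. bump t (dot (?n (fst z)) d) * bump t (dot (?n (snd z)) d))
      \<le> (if parallel (?n (fst z)) (?n (snd z)) then int p ^ 4 else 0) + int p ^ 3"
      by (intro sum_bump_pair_le[OF _ _ M] mem)
  qed
  also have "\<dots> = int (card {z \<in> ?W \<times> ?W. parallel (?n (fst z)) (?n (snd z))}) * int p ^ 4
      + int (card (?W \<times> ?W)) * int p ^ 3"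
    by (simp add: sum.distrib finite_splits flip: sum.inter_filter)
  also have "\<dots> \<le> (324 * int m ^ 3) * int p ^ 4 + (int m ^ 3 * int m ^ 3) * int p ^ 3"
  proof (intro add_mono mult_right_mono)
    have "{z \<in> ?W \<times> ?W. parallel (?n (fst z)) (?n (snd z))}
        = {(v, w). v \<in> ?W \<and> w \<in> ?W \<and> parallel (?n v) (?n w)}"
      by auto
    then have "card {z \<in> ?W \<times> ?W. parallel (?n (fst z)) (?n (snd z))} \<le> 324 * m ^ 3"
      using card_parallel_splits[OF assms(1), of s] by simp
    then show "int (card {z \<in> ?W \<times> ?W. parallel (?n (fst z)) (?n (snd z))}) \<le> 324 * int m ^ 3"
      using of_nat_mono[where 'a = int] by fastforce
    have "card (?W \<times> ?W) \<le> m ^ 3 * m ^ 3"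
      unfolding card_cartesian_product by (intro mult_le_mono card_splits)
    then show "int (card (?W \<times> ?W)) \<le> int m ^ 3 * int m ^ 3"
      using of_nat_mono[where 'a = int] by fastforce
  qed auto
  finally show ?thesis
    by (simp flip: power_add)
qed

end

subsection \<open>Choice of parameters\<close>

lemma sum_swap_pairs:
  "(\<Sum>a\<in>A. \<Sum>b\<in>B. \<Sum>c\<in>C. \<Sum>d\<in>D. f a b c d) = (\<Sum>c\<in>C. \<Sum>d\<in>D. \<Sum>a\<in>A. \<Sum>b\<in>B. f a b c d)"
proof -
  have "(\<Sum>a\<in>A. \<Sum>b\<in>B. \<Sum>c\<in>C. \<Sum>d\<in>D. f a b c d) = (\<Sum>a\<in>A. \<Sum>c\<in>C. \<Sum>d\<in>D. \<Sum>b\<in>B. f a b c d)"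
    by (intro sum.cong refl) (subst sum.swap, intro sum.cong refl sum.swap)
  also have "\<dots> = (\<Sum>c\<in>C. \<Sum>a\<in>A. \<Sum>d\<in>D. \<Sum>b\<in>B. f a b c d)"
    by (rule sum.swap)
  also have "\<dots> = (\<Sum>c\<in>C. \<Sum>d\<in>D. \<Sum>a\<in>A. \<Sum>b\<in>B. f a b c d)"
    by (intro sum.cong refl sum.swap)
  finally show ?thesis .
qed

context odd_prime
begin

section \<open>Excluding degenerate parameters\<close>

definition zero_ind :: "int \<Rightarrow> int" where
  "zero_ind x = (if int p dvd x then 1 else 0)"

lemma sum_zero_ind: "(\<Sum>x\<in>R. zero_ind x) = 1"
proof -
  have "(\<Sum>x\<in>R. zero_ind x) = (\<Sum>x\<in>{0 :: int}. 1)"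
  proof (rule sum.mono_neutral_cong_right)
    show "\<forall>x\<in>R - {0}. zero_ind x = 0"
      using zdvd_not_zless by (auto simp: zero_ind_def)
  qed (use p_pos in \<open>auto simp: zero_ind_def\<close>)
  then show ?thesis by simp
qed

lemma periodic_zero_ind: "periodic zero_ind"
  by (simp add: periodic_def zero_ind_def dvd_mod_iff)

lemma sum_zero_ind_affine: "\<not> int p dvd a \<Longrightarrow> (\<Sum>x\<in>R. zero_ind (a * x + b)) = 1"
  using sum_affine[OF periodic_zero_ind, of a b] by (simp add: sum_zero_ind)

text \<open>Some coordinate of v - w is nonzero and smaller than p in absolute value, so it can be
  solved for once the other two coordinates of d are chosen.\<close>

lemma sum_zero_ind_dot:
  assumes "v \<in> index m" "w \<in> index m" "v \<noteq> w" "m \<le> p"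
  shows "(\<Sum>d\<in>directions. zero_ind (dot (v - w) d)) = (int p)\<^sup>2"
proof -
  obtain a b c where n: "v - w = (a, b, c)" by (cases "v - w")
  have "\<bar>a\<bar> < int m" "\<bar>b\<bar> < int m" "\<bar>c\<bar> < int m"
    using assms(1,2) n by (cases v; cases w; auto simp: index_def cube_def)+
  then have nd: "\<not> int p dvd x" if "x \<in> {a, b, c}" "x \<noteq> 0" for x
    using that assms(4) dvd_imp_le_int[of x "int p"] by auto
  have S: "(\<Sum>d\<in>directions. zero_ind (dot (v - w) d)) =
      (\<Sum>x\<in>R. \<Sum>y\<in>R. \<Sum>z\<in>R. zero_ind (a * x + b * y + c * z))"
    by (simp add: sum_directions n)
  have "(a, b, c) \<noteq> 0"
    using assms(3) by (simp flip: n)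
  then consider "a \<noteq> 0" | "b \<noteq> 0" | "c \<noteq> 0" by (auto simp: zero_prod_def)
  then show ?thesis
  proof cases
    case 1
    have "(\<Sum>x\<in>R. \<Sum>y\<in>R. \<Sum>z\<in>R. zero_ind (a * x + b * y + c * z))
       = (\<Sum>y\<in>R. \<Sum>z\<in>R. \<Sum>x\<in>R. zero_ind (a * x + (b * y + c * z)))"
      by (subst sum.swap, subst (2) sum.swap) (simp add: add.assoc)
    then show ?thesis
      using 1 nd by (simp add: S sum_zero_ind_affine power2_eq_square)
  next
    case 2
    have "(\<Sum>x\<in>R. \<Sum>y\<in>R. \<Sum>z\<in>R. zero_ind (a * x + b * y + c * z))
       = (\<Sum>x\<in>R. \<Sum>z\<in>R. \<Sum>y\<in>R. zero_ind (b * y + (a * x + c * z)))"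
      by (subst (2) sum.swap) (simp add: ac_simps)
    then show ?thesis
      using 2 nd by (simp add: S sum_zero_ind_affine power2_eq_square)
  next
    case 3
    have "(\<Sum>x\<in>R. \<Sum>y\<in>R. \<Sum>z\<in>R. zero_ind (a * x + b * y + c * z))
       = (\<Sum>x\<in>R. \<Sum>y\<in>R. \<Sum>z\<in>R. zero_ind (c * z + (a * x + b * y)))"
      by (simp add: ac_simps)
    then show ?thesis
      using 3 nd by (simp add: S sum_zero_ind_affine power2_eq_square)
  qed
qed

lemma not_dvd_2: "\<not> int p dvd 2"
  using p_gt_2 zdvd_not_zless[of 2 "int p"] by simp

text \<open>Excluding this keeps all sums of two parabola parameters invertible, hence (taking v =
  w) the parameters themselves, and keeps parameters with different indices distinct mod p.\<close>

definition degenerate :: "int \<Rightarrow> int \<times> int \<times> int \<Rightarrow> int \<times> int \<times> int \<Rightarrow> int \<times> int \<times> int \<Rightarrow> bool" where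
  "degenerate t d v w \<longleftrightarrow> int p dvd pt t d v + pt t d w \<or> v \<noteq> w \<and> int p dvd pt t d v - pt t d w"

text \<open>A vanishing sum of points determines t from d, and equal points put d on a plane through
  0; each accounts for at most p^3 of the p^4 parameters.\<close>

lemma sum_degenerate_pair_le:
  assumes "v \<in> index m" "w \<in> index m" "m \<le> p"
  shows "(\<Sum>t\<in>R. \<Sum>d\<in>directions. of_bool (degenerate t d v w) :: int) \<le> 2 * int p ^ 3"
proof -
  have "(\<Sum>t\<in>R. \<Sum>d\<in>directions. of_bool (degenerate t d v w) :: int)
     \<le> (\<Sum>t\<in>R. \<Sum>d\<in>directions. zero_ind (2 * t + 2 * dot (v + w) d)
          + (if v \<noteq> w then 1 else 0) * zero_ind (dot (v - w) d))"
  proof (intro sum_mono)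
    fix t d
    have 1: "pt t d v + pt t d w = 2 * (t + t) - 2 * t + 2 * dot (v + w) d"
      by (simp add: pt_def dot_add_left)
    have 2: "pt t d v - pt t d w = 2 * dot (v - w) d"
      by (simp add: pt_def dot_diff_left)
    have "int p dvd 2 * dot (v - w) d \<longleftrightarrow> int p dvd dot (v - w) d"
      using prime_dvd_mult_iff[OF prime_int_p] not_dvd_2 by blast
    then show "of_bool (degenerate t d v w) \<le> zero_ind (2 * t + 2 * dot (v + w) d)
          + (if v \<noteq> w then 1 else 0) * zero_ind (dot (v - w) d)"
      by (auto simp: degenerate_def zero_ind_def 1 2)
  qed
  also have "\<dots> = (\<Sum>d\<in>directions. \<Sum>t\<in>R. zero_ind (2 * t + 2 * dot (v + w) d))
      + (if v \<noteq> w then 1 else 0) * (\<Sum>t\<in>R. \<Sum>d\<in>directions. zero_ind (dot (v - w) d))"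
    by (simp only: sum.distrib sum_distrib_left) (subst sum.swap, rule refl)
  also have "\<dots> \<le> int p ^ 3 + int p * (int p)\<^sup>2"
    using sum_zero_ind_dot[OF assms(1,2) _ assms(3)]
    by (cases "v = w") (simp_all add: sum_zero_ind_affine[OF not_dvd_2] card_directions)
  finally show ?thesis
    by (simp add: power2_eq_square power3_eq_cube)
qed

definition energy :: "nat \<Rightarrow> int \<Rightarrow> int \<times> int \<times> int \<Rightarrow> int" where
  "energy m t d = (\<Sum>s\<in>index_sums m. (corr m t d s)\<^sup>2)"

text \<open>An averaging argument. If the claim failed, the energy would be at least 5200 m^6 (1 -
  bad) for all parameters, where bad counts the degenerate pairs. On average bad is at most 1/2, so
  the mean energy would be at least 2600 m^6, whereas the mean square estimate bounds it by 2594
  m^6.\<close>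

lemma good_parameters:
  assumes m: "m \<ge> 1" and p: "4 * m ^ 6 \<le> p"
  obtains t d where "\<And>v w. v \<in> index m \<Longrightarrow> w \<in> index m \<Longrightarrow> \<not> degenerate t d v w"
    "energy m t d \<le> 5200 * int m ^ 6"
proof (rule ccontr)
  note that' = that
  assume neg: "\<not> thesis"
  let ?bad = "\<lambda>t d. \<Sum>v\<in>index m. \<Sum>w\<in>index m. of_bool (degenerate t d v w) :: int"
  have m6: "m ^ k \<le> m ^ 6" if "k \<le> 6" for k
    using that m by (intro power_increasing) auto
  have "0 < m ^ 6" using m by simp
  then have mp: "m \<le> p" "2 * m\<^sup>2 < p"
    using m6[of 1] m6[of 2] p by (simp_all only: power_one_right) linarith+
  have p': "4 * int m ^ 6 \<le> int p"
    using p of_nat_le_iff[of "4 * m ^ 6" p, where 'a = int] by simp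
  \<comment> \<open>For degenerate parameters the left side is at most 0; for all others bad
    vanishes and the negated claim applies.\<close>
  have low: "5200 * int m ^ 6 * (1 - ?bad t d) \<le> energy m t d" for t d
  proof (cases "\<exists>v\<in>index m. \<exists>w\<in>index m. degenerate t d v w")
    case True
    then obtain v w where vw: "v \<in> index m" "w \<in> index m" "degenerate t d v w" by blast
    have "1 \<le> (\<Sum>w\<in>index m. of_bool (degenerate t d v w) :: int)"
      using member_le_sum[of w "index m" "\<lambda>w. of_bool (degenerate t d v w) :: int"] vw finite_index by simp
    also have "\<dots> \<le> ?bad t d"
      using member_le_sum[of v "index m" "\<lambda>v. \<Sum>w\<in>index m. of_bool (degenerate t d v w) :: int"] vw finite_index
      by (simp add: sum_nonneg)
    finally have "5200 * int m ^ 6 * (1 - ?bad t d) \<le> 0"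
      by (intro mult_nonneg_nonpos) auto
    also have "0 \<le> energy m t d"
      by (simp add: energy_def sum_nonneg)
    finally show ?thesis .
  next
    case False
    then have "\<not> energy m t d \<le> 5200 * int m ^ 6"
      using neg that' by blast
    moreover have "?bad t d = 0"
      using False by (intro sum.neutral ballI) auto
    ultimately show ?thesis by simp
  qed
  have bad: "(\<Sum>t\<in>R. \<Sum>d\<in>directions. ?bad t d) \<le> 2 * int m ^ 6 * int p ^ 3"
  proof -
    have "(\<Sum>t\<in>R. \<Sum>d\<in>directions. ?bad t d) =
        (\<Sum>v\<in>index m. \<Sum>w\<in>index m. \<Sum>t\<in>R. \<Sum>d\<in>directions. of_bool (degenerate t d v w))"
      by (rule sum_swap_pairs)
    also have "\<dots> \<le> (\<Sum>v\<in>index m. \<Sum>w\<in>index m. 2 * int p ^ 3)"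
      by (intro sum_mono sum_degenerate_pair_le[OF _ _ mp(1)])
    also have "\<dots> = 2 * int m ^ 6 * int p ^ 3"
      by (simp add: card_index flip: power_add)
    finally show ?thesis .
  qed
  have "(\<Sum>t\<in>R. \<Sum>d\<in>directions. 5200 * int m ^ 6 * (1 - ?bad t d)) \<le> (\<Sum>t\<in>R. \<Sum>d\<in>directions. energy m t d)"
    by (intro sum_mono low)
  also have "\<dots> = (\<Sum>s\<in>index_sums m. \<Sum>t\<in>R. \<Sum>d\<in>directions. (corr m t d s)\<^sup>2)"
  proof -
    have "(\<Sum>t\<in>R. \<Sum>d\<in>directions. energy m t d) = (\<Sum>t\<in>R. \<Sum>s\<in>index_sums m. \<Sum>d\<in>directions. (corr m t d s)\<^sup>2)"
      unfolding energy_def by (intro sum.cong refl sum.swap)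
    also have "\<dots> = (\<Sum>s\<in>index_sums m. \<Sum>t\<in>R. \<Sum>d\<in>directions. (corr m t d s)\<^sup>2)"
      by (rule sum.swap)
    finally show ?thesis .
  qed
  also have "\<dots> \<le> (\<Sum>s\<in>index_sums m. 324 * int m ^ 3 * int p ^ 4 + int m ^ 6 * int p ^ 3)"
    by (intro sum_mono sum_corr_square_le m mp)
  \<comment> \<open>Here 2592 = 8 * 324, as there are 8 m^3 sums s.\<close>
  also have "\<dots> = 2592 * int m ^ 6 * int p ^ 4 + 8 * int m ^ 3 * (int m ^ 6 * int p ^ 3)"
    by (simp add: card_index_sums algebra_simps flip: power_add)
  finally have upper: "(\<Sum>t\<in>R. \<Sum>d\<in>directions. 5200 * int m ^ 6 * (1 - ?bad t d))
      \<le> 2592 * int m ^ 6 * int p ^ 4 + 8 * int m ^ 3 * (int m ^ 6 * int p ^ 3)" .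
  have eq: "(\<Sum>t\<in>R. \<Sum>d\<in>directions. 5200 * int m ^ 6 * (1 - ?bad t d))
     = 5200 * int m ^ 6 * (int p ^ 4 - (\<Sum>t\<in>R. \<Sum>d\<in>directions. ?bad t d))"
  proof -
    have "(\<Sum>t\<in>R. \<Sum>d\<in>directions. (1::int)) = int p ^ 4"
      by (simp add: card_directions power_numeral_reduce)
    then show ?thesis
      by (simp only: sum_distrib_left[symmetric] sum_subtractf)
  qed
  have pp: "4 * (int m ^ 6 * int p ^ 3) \<le> int p ^ 4"
    using mult_right_mono[OF p', of "int p ^ 3"] by (simp add: power_numeral_reduce mult.assoc)
  have "int m ^ 3 \<le> int m ^ 6"
    using m by (intro power_increasing) auto
  then have "8 * int m ^ 3 * (int m ^ 6 * int p ^ 3) \<le> 8 * int m ^ 6 * (int m ^ 6 * int p ^ 3)"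
    by (intro mult_right_mono mult_left_mono) auto
  also have "\<dots> = 2 * int m ^ 6 * (4 * (int m ^ 6 * int p ^ 3))"
    by simp
  also have "\<dots> \<le> 2 * int m ^ 6 * int p ^ 4"
    by (intro mult_left_mono pp) auto
  finally have small: "8 * int m ^ 3 * (int m ^ 6 * int p ^ 3) \<le> 2 * int m ^ 6 * int p ^ 4" .
  have "y \<le> 2 * (y - b)" if "b \<le> 2 * x" "4 * x \<le> y" for b x y :: int
    using that by (simp add: right_diff_distrib)
  from this[OF bad[unfolded mult.assoc] pp]
  have "2 * (int p ^ 4 - (\<Sum>t\<in>R. \<Sum>d\<in>directions. ?bad t d)) \<ge> int p ^ 4" .
  then have "int m ^ 6 * int p ^ 4 \<le> int m ^ 6 * (2 * (int p ^ 4 - (\<Sum>t\<in>R. \<Sum>d\<in>directions. ?bad t d)))"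
    by (intro mult_left_mono) auto
  \<comment> \<open>With x = m^6 and y = p^4 the hypotheses give 2600 x y <= 2594 x y.\<close>
  moreover have "x * y \<le> 0"
    if "x * y \<le> x * (2 * (y - b))" "5200 * x * (y - b) \<le> 2592 * x * y + c" "c \<le> 2 * x * y"
    for b c x y :: int
    using that by (simp add: algebra_simps)
  ultimately have "int m ^ 6 * int p ^ 4 \<le> 0"
    using upper[unfolded eq] small by blast
  moreover have "int m ^ 6 * int p ^ 4 > 0"
    using m p_pos by simp
  ultimately show False by linarith
qed

text \<open>A solution z gives (c z)^2 = c D mod p, so chi(c D) = chi(z)^2. All solutions are z or
  -z mod p: at most two if z is nonzero mod p, one otherwise. Without solutions the bound is
  trivial.\<close>

lemma card_square_solutions_le:
  assumes c: "\<not> int p dvd c"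
  shows "int (card {z\<in>R. [c * z\<^sup>2 = D] (mod int p)}) \<le> 1 + chi (c * D)"
proof -
  let ?Z = "{z\<in>R. [c * z\<^sup>2 = D] (mod int p)}"
  show ?thesis
  proof (cases "?Z = {}")
    case True
    then have "int (card ?Z) = 0" by (simp only: card.empty of_nat_0)
    then show ?thesis
      using abs_chi_le[of "c * D"] by linarith
  next
    case False
    then obtain z where z: "z \<in> R" "[c * z\<^sup>2 = D] (mod int p)" by blast
    have "[(c * z)\<^sup>2 = c * D] (mod int p)"
      using cong_mult[OF cong_refl z(2), of c] by (simp add: power2_eq_square ac_simps)
    then have "chi (c * D) = chi ((c * z)\<^sup>2)"
      by (rule chi_cong[symmetric])
    also have "\<dots> = chi (c * z) * chi (c * z)"
      by (simp only: power2_eq_square chi_mult)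
    also have "\<dots> = chi z * chi z"
      by (rule chi_square_factor[OF c])
    finally have chi: "chi (c * D) = chi z * chi z" .
    have dvd: "int p dvd z' - z \<or> int p dvd z' + z" if "z' \<in> ?Z" for z'
    proof -
      have "[c * z'\<^sup>2 = c * z\<^sup>2] (mod int p)"
        using that z(2) by (simp add: cong_def)
      then have "int p dvd c * ((z' - z) * (z' + z))"
        by (simp add: cong_iff_dvd_diff power2_eq_square algebra_simps)
      then show ?thesis
        using c prime_dvd_mult_iff[OF prime_int_p] by blast
    qed
    show ?thesis
    proof (cases "int p dvd z")
      case True
      then have "int p dvd z' - z" if "z' \<in> ?Z" for z'
        using dvd[OF that] True dvd_diff[of "int p" "z' + z" "z + z"] by auto
      then have "?Z \<subseteq> {z}"
        using z R_eq_if_dvd_diff by blast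
      then have "card ?Z \<le> 1"
        using card_mono[of "{z}"] by simp
      moreover have "chi z = 0"
        using True by (simp only: chi_eq_0_iff)
      ultimately show ?thesis
        using chi by simp
    next
      case False
      have "?Z \<subseteq> {z, (- z) mod int p}"
      proof
        fix z' assume z': "z' \<in> ?Z"
        from dvd[OF this] show "z' \<in> {z, (- z) mod int p}"
        proof
          assume "int p dvd z' - z"
          then show ?thesis using z' z(1) R_eq_if_dvd_diff by blast
        next
          assume "int p dvd z' + z"
          then have "z' mod int p = (- z) mod int p"
            by (simp add: mod_eq_dvd_iff)
          then show ?thesis using z' by simp
        qed
      qed
      then have "card ?Z \<le> card {z, (- z) mod int p}"
        by (intro card_mono) auto
      also have "\<dots> \<le> 2"
        by (simp add: card_insert_if)
      finally have "int (card ?Z) \<le> 2" by simp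
      moreover have "chi z * chi z = 1"
        using False chi_values[of z] chi_eq_0_iff[of z] by auto
      ultimately show ?thesis
        using chi by simp
    qed
  qed
qed

text \<open>The identity \<open>(u + v)(u x\<^sup>2 + v y\<^sup>2) = (u x + v y)\<^sup>2 + u v (x - y)\<^sup>2\<close> reduces the count
  of representations by two parabolas to a count of square roots.\<close>

lemma card_parabola_sum_le:
  assumes u: "\<not> int p dvd u" and v: "\<not> int p dvd v" and uv: "\<not> int p dvd u + v"
  shows "int (card {(x, y). x \<in> R \<and> y \<in> R \<and> [u * x + v * y = a] (mod int p) \<and>
      [u * x\<^sup>2 + v * y\<^sup>2 = b] (mod int p)}) \<le> 1 + chi u * chi v * chi ((u + v) * b - a\<^sup>2)"
proof -
  let ?P = "{(x, y). x \<in> R \<and> y \<in> R \<and> [u * x + v * y = a] (mod int p) \<and>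
      [u * x\<^sup>2 + v * y\<^sup>2 = b] (mod int p)}"
  let ?D = "(u + v) * b - a\<^sup>2"
  let ?Z = "{z\<in>R. [(u * v) * z\<^sup>2 = ?D] (mod int p)}"
  let ?h = "\<lambda>(x, y). (x - y) mod int p"
  have "card ?P \<le> card ?Z"
  proof (rule card_inj_on_le)
    show "inj_on ?h ?P"
    proof (rule inj_onI)
      fix z z' assume z: "z \<in> ?P" "z' \<in> ?P" "?h z = ?h z'"
      obtain x y x' y' where e: "z = (x, y)" "z' = (x', y')"
        by (cases z, cases z') auto
      have 1: "int p dvd (x - y) - (x' - y')"
        using z by (simp add: e mod_eq_dvd_iff)
      have "[u * x + v * y = u * x' + v * y'] (mod int p)"
        using z by (auto simp: e cong_def)
      then have 2: "int p dvd (u * x + v * y) - (u * x' + v * y')"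
        by (simp add: cong_iff_dvd_diff)
      \<comment> \<open>Eliminating y leaves (u + v) (x - x'): given a, the difference x - y
        determines the solution because u + v is invertible.\<close>
      have "int p dvd ((u * x + v * y) - (u * x' + v * y')) + v * ((x - y) - (x' - y'))"
        using 1 2 by (intro dvd_add dvd_mult)
      then have "int p dvd (u + v) * (x - x')"
        by (simp add: algebra_simps)
      then have x: "int p dvd x - x'"
        using uv prime_dvd_mult_iff[OF prime_int_p] by blast
      have "int p dvd (x - x') - ((x - y) - (x' - y'))"
        using 1 x by (rule dvd_diff[rotated])
      then have "int p dvd y - y'"
        by (simp add: algebra_simps)
      with x show "z = z'"
        using z R_eq_if_dvd_diff by (auto simp: e)
    qed
    have "(x - y) mod int p \<in> ?Z" if xy: "x \<in> R" "y \<in> R" "[u * x + v * y = a] (mod int p)"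
        "[u * x\<^sup>2 + v * y\<^sup>2 = b] (mod int p)" for x y
    proof -
      have "[(u + v) * (u * x\<^sup>2 + v * y\<^sup>2) - (u * x + v * y)\<^sup>2 = ?D] (mod int p)"
        using xy by (intro cong_diff cong_mult cong_pow cong_refl)
      moreover have "(u + v) * (u * x\<^sup>2 + v * y\<^sup>2) - (u * x + v * y)\<^sup>2 = (u * v) * (x - y)\<^sup>2"
        by (simp add: power2_eq_square algebra_simps)
      moreover have "[(u * v) * ((x - y) mod int p)\<^sup>2 = (u * v) * (x - y)\<^sup>2] (mod int p)"
        by (intro cong_mult cong_pow cong_refl) (simp add: cong_def)
      ultimately have "[(u * v) * ((x - y) mod int p)\<^sup>2 = ?D] (mod int p)"
        by (simp add: cong_def)
      then show ?thesis
        using mod_in_R by blast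
    qed
    then show "?h ` ?P \<subseteq> ?Z" by auto
    show "finite ?Z" by (rule finite_subset[of _ R]) auto
  qed
  then have "int (card ?P) \<le> int (card ?Z)" by simp
  also have "\<dots> \<le> 1 + chi ((u * v) * ?D)"
    using u v prime_dvd_mult_iff[OF prime_int_p] by (intro card_square_solutions_le) blast
  finally show ?thesis
    by (simp add: chi_mult)
qed

end

subsection \<open>Unions of parabolas\<close>

definition planar_reps :: "nat \<Rightarrow> (int \<times> int) set \<Rightarrow> int \<Rightarrow> int \<Rightarrow> ((int \<times> int) \<times> (int \<times> int)) set" where
  "planar_reps p B a b = {(P, Q). P \<in> B \<and> Q \<in> B \<and>
     [fst P + fst Q = a] (mod int p) \<and> [snd P + snd Q = b] (mod int p)}"

lemma finite_planar_reps: "finite B \<Longrightarrow> finite (planar_reps p B a b)"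
  by (rule finite_subset[of _ "B \<times> B"]) (auto simp: planar_reps_def)

text \<open>Pairs are grouped by their sum s, the only quantity on which the sum of the two parabola
  parameters depends.\<close>

lemma sum_index_pairs:
  "(\<Sum>(v, w)\<in>index m \<times> index m. f v w) = (\<Sum>s\<in>index_sums m. \<Sum>v\<in>splits m s. f v (s - v))"
proof -
  have "(\<Sum>(v, w)\<in>index m \<times> index m. f v w) = (\<Sum>(s, v)\<in>Sigma (index_sums m) (splits m). f v (s - v))"
    by (rule sum.reindex_bij_witness[where j = "\<lambda>(v, w). (v + w, v)" and i = "\<lambda>(s, v). (v, s - v)"])
       (auto simp: splits_def index_def index_sums_def cube_def)
  then show ?thesis
    by (simp add: sum.Sigma finite_index_sums finite_splits)
qed

context odd_prime
begin

definition parabola_point :: "int \<Rightarrow> int \<times> int \<times> int \<Rightarrow> (int \<times> int \<times> int) \<times> int \<Rightarrow> int \<times> int" where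
  "parabola_point t d = (\<lambda>(w, x). (pt t d w * x mod int p, pt t d w * x\<^sup>2 mod int p))"

definition parabolas :: "nat \<Rightarrow> int \<Rightarrow> int \<times> int \<times> int \<Rightarrow> (int \<times> int) set" where
  "parabolas m t d = parabola_point t d ` (index m \<times> R)"

lemma parabolas_subset: "parabolas m t d \<subseteq> R \<times> R"
  using mod_in_R by (auto simp: parabolas_def parabola_point_def)

context
  fixes m :: nat and t :: int and d :: "int \<times> int \<times> int"
  assumes nondeg: "\<And>v w. v \<in> index m \<Longrightarrow> w \<in> index m \<Longrightarrow> \<not> degenerate t d v w"
begin

lemma pt_not_dvd:
  assumes "v \<in> index m"
  shows "\<not> int p dvd pt t d v"
proof
  assume "int p dvd pt t d v"
  then have "int p dvd pt t d v + pt t d v" by (rule dvd_add) fact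
  then show False
    using nondeg[OF assms assms] by (simp add: degenerate_def)
qed

text \<open>The parabolas meet only in the origin: for x nonzero, the ratio of the coordinates of a
  point gives x, then the parameter, and by nondegeneracy the index. Discarding x = 0 leaves p - 1
  points on each.\<close>

lemma card_parabolas_ge: "m ^ 3 * (p - 1) \<le> card (parabolas m t d)"
proof -
  have inj: "inj_on (parabola_point t d) (index m \<times> (R - {0}))"
  proof (rule inj_onI)
    fix z z' assume z: "z \<in> index m \<times> (R - {0})" "z' \<in> index m \<times> (R - {0})"
      "parabola_point t d z = parabola_point t d z'"
    obtain v x w y where e: "z = (v, x)" "z' = (w, y)"
      by (cases z, cases z') auto
    have x: "\<not> int p dvd x"
      using z(1) zdvd_not_zless by (auto simp: e)
    have 1: "int p dvd pt t d v * x - pt t d w * y" "int p dvd pt t d v * x\<^sup>2 - pt t d w * y\<^sup>2"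
      using z(3) by (auto simp: e parabola_point_def mod_eq_dvd_iff)
    \<comment> \<open>This combination equals u x (x - y) with u = \<open>pt t d v\<close>.\<close>
    have "int p dvd (pt t d v * x\<^sup>2 - pt t d w * y\<^sup>2) - y * (pt t d v * x - pt t d w * y)"
      by (rule dvd_diff[OF 1(2) dvd_mult[OF 1(1)]])
    then have "int p dvd pt t d v * (x * (x - y))"
      by (simp add: algebra_simps power2_eq_square)
    then have "int p dvd x - y"
      using pt_not_dvd z(1) x prime_dvd_mult_iff[OF prime_int_p] by (auto simp: e)
    then have xy: "x = y"
      using z R_eq_if_dvd_diff by (auto simp: e)
    have "int p dvd (pt t d v - pt t d w) * x"
      using 1(1) by (simp add: xy algebra_simps)
    then have "int p dvd pt t d v - pt t d w"
      using x prime_dvd_mult_iff[OF prime_int_p] by blast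
    then have "v = w"
      using nondeg[of v w] z by (auto simp: e degenerate_def)
    then show "z = z'"
      by (simp add: e xy)
  qed
  have "card (index m \<times> (R - {0})) = m ^ 3 * (p - 1)"
    using p_gt_2 by (simp add: card_cartesian_product card_index card_Diff_singleton)
  then have "m ^ 3 * (p - 1) = card (parabola_point t d ` (index m \<times> (R - {0})))"
    using card_image[OF inj] by simp
  also have "\<dots> \<le> card (parabolas m t d)"
    unfolding parabolas_def by (intro card_mono) (auto simp: finite_index)
  finally show ?thesis .
qed

text \<open>A union bound over pairs of parabolas. The constant terms give m^6. In the character
  terms the symbol containing a and b depends only on s = v + w, so it factors out of the inner sum,
  which is \<open>corr\<close>; bounding it by 1 makes the estimate uniform in a and b.\<close>

lemma card_planar_reps_parabolas_le:
  "int (card (planar_reps p (parabolas m t d) a b)) \<le> int m ^ 6 + (\<Sum>s\<in>index_sums m. \<bar>corr m t d s\<bar>)"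
proof -
  let ?I = "index m \<times> index m" and ?u = "pt t d"
  define sols where "sols = (\<lambda>(v, w). {(x, y). x \<in> R \<and> y \<in> R \<and> [?u v * x + ?u w * y = a] (mod int p) \<and>
      [?u v * x\<^sup>2 + ?u w * y\<^sup>2 = b] (mod int p)})"
  define h where "h = (\<lambda>(v, w) (x, y). (parabola_point t d (v, x), parabola_point t d (w, y)))"
  have fin: "finite (sols z)" for z
    by (rule finite_subset[of _ "R \<times> R"]) (auto simp: sols_def)
  have sub: "planar_reps p (parabolas m t d) a b \<subseteq> (\<Union>z\<in>?I. h z ` sols z)"
  proof
    fix z assume "z \<in> planar_reps p (parabolas m t d) a b"
    then obtain v x w y where z: "v \<in> index m" "w \<in> index m" "x \<in> R" "y \<in> R"
        "z = (parabola_point t d (v, x), parabola_point t d (w, y))"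
        "[fst (fst z) + fst (snd z) = a] (mod int p)" "[snd (fst z) + snd (snd z) = b] (mod int p)"
      by (fastforce simp: planar_reps_def parabolas_def)
    then have "(x, y) \<in> sols (v, w)"
      by (simp add: sols_def parabola_point_def cong_def mod_add_eq)
    then show "z \<in> (\<Union>z\<in>?I. h z ` sols z)"
      using z by (intro UN_I[of "(v, w)"] image_eqI[of _ _ "(x, y)"]) (auto simp: h_def)
  qed
  have "card (planar_reps p (parabolas m t d) a b) \<le> card (\<Union>z\<in>?I. h z ` sols z)"
    by (rule card_mono[OF _ sub]) (auto simp: finite_index fin)
  also have "\<dots> \<le> (\<Sum>z\<in>?I. card (h z ` sols z))"
    by (rule card_UN_le) (simp add: finite_index)
  also have "\<dots> \<le> (\<Sum>z\<in>?I. card (sols z))"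
    by (intro sum_mono card_image_le fin)
  finally have "int (card (planar_reps p (parabolas m t d) a b)) \<le> int (\<Sum>z\<in>?I. card (sols z))"
    by (simp only: of_nat_le_iff)
  also have "\<dots> = (\<Sum>z\<in>?I. int (card (sols z)))"
    by (rule of_nat_sum)
  also have "\<dots> \<le> (\<Sum>(v, w)\<in>?I. 1 + chi (?u v) * chi (?u w) * chi ((?u v + ?u w) * b - a\<^sup>2))"
  proof (rule sum_mono)
    fix z assume z: "z \<in> ?I"
    obtain v w where e: "z = (v, w)" by (cases z)
    have "\<not> int p dvd ?u v + ?u w"
      using nondeg[of v w] z by (auto simp: e degenerate_def)
    then show "int (card (sols z)) \<le> (case z of (v, w) \<Rightarrow> 1 + chi (?u v) * chi (?u w) * chi ((?u v + ?u w) * b - a\<^sup>2))"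
      using card_parabola_sum_le[of "?u v" "?u w" a b] pt_not_dvd z by (simp add: e sols_def)
  qed
  also have "\<dots> = int m ^ 6 + (\<Sum>(v, w)\<in>?I. chi (?u v) * chi (?u w) * chi ((?u v + ?u w) * b - a\<^sup>2))"
    by (simp add: case_prod_unfold sum.distrib card_cartesian_product card_index flip: power_add)
  also have "(\<Sum>(v, w)\<in>?I. chi (?u v) * chi (?u w) * chi ((?u v + ?u w) * b - a\<^sup>2))
     = (\<Sum>s\<in>index_sums m. corr m t d s * chi ((2 * t + 2 * dot s d) * b - a\<^sup>2))"
  proof -
    have "?u v + ?u (s - v) = 2 * t + 2 * dot s d" for s v
      by (simp add: pt_def dot_diff_left)
    then show ?thesis
      by (simp add: sum_index_pairs corr_def sum_distrib_right)
  qed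
  also have "\<dots> \<le> (\<Sum>s\<in>index_sums m. \<bar>corr m t d s\<bar>)"
  proof (rule sum_mono)
    fix s
    let ?c = "chi ((2 * t + 2 * dot s d) * b - a\<^sup>2)"
    have "corr m t d s * ?c \<le> \<bar>corr m t d s\<bar> * \<bar>?c\<bar>"
      by (simp flip: abs_mult)
    also have "\<dots> \<le> \<bar>corr m t d s\<bar> * 1"
      by (intro mult_left_mono abs_chi_le abs_ge_zero)
    finally show "corr m t d s * ?c \<le> \<bar>corr m t d s\<bar>" by simp
  qed
  finally show ?thesis by simp
qed

end

text \<open>Cauchy-Schwarz over the 8 m^3 sums s; the constant comes from 8 * 5200 = 41600 <=
  204^2.\<close>

lemma sum_abs_corr_le:
  assumes "energy m t d \<le> 5200 * int m ^ 6"
  shows "real_of_int (\<Sum>s\<in>index_sums m. \<bar>corr m t d s\<bar>) \<le> 204 * sqrt (real m ^ 9)"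
proof -
  have "(\<Sum>s\<in>index_sums m. real_of_int \<bar>corr m t d s\<bar>)\<^sup>2
      \<le> (\<Sum>s\<in>index_sums m. (real_of_int \<bar>corr m t d s\<bar>)\<^sup>2) * real (card (index_sums m))"
    by (rule sum_squared_le_sum_of_squares)
  also have "(\<Sum>s\<in>index_sums m. (real_of_int \<bar>corr m t d s\<bar>)\<^sup>2) = real_of_int (energy m t d)"
    by (simp add: energy_def)
  also have "\<dots> * real (card (index_sums m)) \<le> (5200 * real m ^ 6) * real (card (index_sums m))"
  proof (rule mult_right_mono)
    have "real_of_int (energy m t d) \<le> real_of_int (5200 * int m ^ 6)"
      using assms by (simp only: of_int_le_iff)
    then show "real_of_int (energy m t d) \<le> 5200 * real m ^ 6" by simp
  qed simp
  also have "\<dots> = 41600 * real m ^ 9"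
    by (simp add: card_index_sums flip: power_add)
  also have "\<dots> \<le> (204 * sqrt (real m ^ 9))\<^sup>2"
    by (simp add: power_mult_distrib)
  finally have "(\<Sum>s\<in>index_sums m. real_of_int \<bar>corr m t d s\<bar>) \<le> 204 * sqrt (real m ^ 9)"
    by (rule power2_le_imp_le) simp
  then show ?thesis by simp
qed

lemma ex_planar_set:
  assumes "m \<ge> 1" "4 * m ^ 6 \<le> p"
  obtains B where "B \<subseteq> R \<times> R" "m ^ 3 * (p - 1) \<le> card B"
    "\<And>a b. real (card (planar_reps p B a b)) \<le> real m ^ 6 + 204 * sqrt (real m ^ 9)"
proof -
  obtain t d where td: "\<And>v w. v \<in> index m \<Longrightarrow> w \<in> index m \<Longrightarrow> \<not> degenerate t d v w"
    "energy m t d \<le> 5200 * int m ^ 6"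
    using good_parameters[OF assms] by blast
  show thesis
  proof
    show "parabolas m t d \<subseteq> R \<times> R"
      by (rule parabolas_subset)
    show "m ^ 3 * (p - 1) \<le> card (parabolas m t d)"
      by (rule card_parabolas_ge) (rule td)
    fix a b
    have "real_of_int (int (card (planar_reps p (parabolas m t d) a b)))
      \<le> real_of_int (int m ^ 6 + (\<Sum>s\<in>index_sums m. \<bar>corr m t d s\<bar>))"
      unfolding of_int_le_iff by (rule card_planar_reps_parabolas_le) (rule td)
    also have "\<dots> \<le> real m ^ 6 + 204 * sqrt (real m ^ 9)"
      using sum_abs_corr_le[OF td(2)] by simp
    finally show "real (card (planar_reps p (parabolas m t d) a b)) \<le> real m ^ 6 + 204 * sqrt (real m ^ 9)"
      by simp
  qed
qed

end

subsection \<open>From the plane to a cyclic group\<close>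

text \<open>The integer with mixed radix digits x, c, y in bases p, s, p, lowest first; c is the
  free digit of the blow-up.\<close>

definition unfold_plane :: "nat \<Rightarrow> nat \<Rightarrow> (int \<times> int) \<times> int \<Rightarrow> int" where
  "unfold_plane p s = (\<lambda>((x, y), c). x + int p * (c + int s * y))"

lemma unfold_plane_bound:
  assumes "0 < p" "0 < s" "x \<in> {0..<int p}" "y \<in> {0..<int p}" "c \<in> {0..<int s}"
  shows "unfold_plane p s ((x, y), c) \<in> {0..<int (p * p * s)}"
proof -
  have "int s * y \<le> int s * (int p - 1)"
    using assms by (intro mult_left_mono) auto
  then have "c + int s * y \<le> int s * int p - 1"
    using assms by (simp add: algebra_simps)
  then have "int p * (c + int s * y) \<le> int p * (int s * int p - 1)"
    by (intro mult_left_mono) auto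
  then have "x + int p * (c + int s * y) < int p * (int s * int p)"
    using assms by (simp add: algebra_simps)
  then show ?thesis
    using assms by (simp add: unfold_plane_def ac_simps)
qed

lemma inj_unfold_plane:
  assumes "0 < p" "0 < s"
  shows "inj_on (unfold_plane p s) (({0..<int p} \<times> {0..<int p}) \<times> {0..<int s})"
proof (rule inj_onI)
  fix z z' assume z: "z \<in> ({0..<int p} \<times> {0..<int p}) \<times> {0..<int s}"
    "z' \<in> ({0..<int p} \<times> {0..<int p}) \<times> {0..<int s}" "unfold_plane p s z = unfold_plane p s z'"
  obtain x y c x' y' c' where e: "z = ((x, y), c)" "z' = ((x', y'), c')"
    by (cases z, cases z') auto
  have mem: "x \<in> {0..<int p}" "x' \<in> {0..<int p}" "c \<in> {0..<int s}" "c' \<in> {0..<int s}"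
    using z by (auto simp: e)
  have eq: "x + int p * (c + int s * y) = x' + int p * (c' + int s * y')"
    using z(3) by (simp add: e unfold_plane_def)
  then have "(x + int p * (c + int s * y)) mod int p = (x' + int p * (c' + int s * y')) mod int p"
    by simp
  then have x: "x = x'"
    using mem by simp
  with eq have eq2: "c + int s * y = c' + int s * y'"
    using assms by simp
  then have "(c + int s * y) mod int s = (c' + int s * y') mod int s"
    by simp
  then have c: "c = c'"
    using mem by simp
  with eq2 have "y = y'"
    using assms by simp
  with x c show "z = z'"
    by (simp add: e)
qed

text \<open>When two unfolded points are added, the carry from the first coordinates is absorbed
  into the second digit, \<open>d = c' + (x + x') div p\<close>. As \<open>0 \<le> d \<le> s\<close> and \<open>c\<close> is determined
  by \<open>d\<close> modulo \<open>s\<close>, only \<open>s + 1\<close> pairs \<open>(c, d)\<close> occur, and each of them fixes the sum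
  of the two planar points.\<close>

lemma Sidon_unfold_plane:
  assumes p: "0 < p" and s: "0 < s" and B: "B \<subseteq> {0..<int p} \<times> {0..<int p}"
    and G: "\<And>a b. card (planar_reps p B a b) \<le> G"
  defines "A \<equiv> unfold_plane p s ` (B \<times> {0..<int s})"
  shows "Sidon (integer_mod_group (p * p * s)) ((s + 1) * G) A" "card A = s * card B"
proof -
  let ?q = "p * p * s" and ?D = "B \<times> {0..<int s}"
  have q: "0 < ?q" using p s by simp
  have finB: "finite B"
    using B by (rule finite_subset) simp
  have "inj_on (unfold_plane p s) ?D"
    by (rule inj_on_subset[OF inj_unfold_plane[OF p s]]) (use B in auto)
  then show "card A = s * card B"
    by (simp add: A_def card_image card_cartesian_product)
  have finA: "finite A"
    by (simp add: A_def finB)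
  have sub: "A \<subseteq> carrier (integer_mod_group ?q)"
    using B p s unfold_plane_bound[OF p s]
    by (auto simp: A_def carrier_integer_mod_group simp del: of_nat_mult)
  have "finite (reps (integer_mod_group ?q) A z) \<and> card (reps (integer_mod_group ?q) A z) \<le> (s + 1) * G"
    if z: "z \<in> carrier (integer_mod_group ?q)" for z
  proof
    show "finite (reps (integer_mod_group ?q) A z)"
      by (rule finite_subset[of _ "A \<times> A"]) (auto simp: reps_def finA)
    define T where "T = {(e, f). e \<in> ?D \<and> f \<in> ?D \<and>
      [unfold_plane p s e + unfold_plane p s f = z] (mod int ?q)}"
    have finT: "finite T"
      by (rule finite_subset[of _ "?D \<times> ?D"]) (auto simp: T_def finB)
    have "reps (integer_mod_group ?q) A z \<subseteq> map_prod (unfold_plane p s) (unfold_plane p s) ` T"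
    proof
      fix w assume "w \<in> reps (integer_mod_group ?q) A z"
      then obtain e f where ef: "e \<in> ?D" "f \<in> ?D" "w = (unfold_plane p s e, unfold_plane p s f)"
        "(unfold_plane p s e + unfold_plane p s f) mod int ?q = z"
        using q by (auto simp: reps_def A_def mult_integer_mod_group simp del: of_nat_mult)
      then have "(e, f) \<in> T"
        by (auto simp: T_def cong_def simp del: of_nat_mult)
      then show "w \<in> map_prod (unfold_plane p s) (unfold_plane p s) ` T"
        using ef(3) by (auto intro!: image_eqI[of _ _ "(e, f)"])
    qed
    then have "card (reps (integer_mod_group ?q) A z) \<le> card T"
      using finT by (intro order_trans[OF card_mono card_image_le]) auto
    \<comment> \<open>What remains of z above its lowest digit in base p.\<close>
    define m where "m = z div int p"
    define K where "K = {(c, d). c \<in> {0..<int s} \<and> d \<in> {0..int s} \<and> int s dvd m - c - d}"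
    have finK: "finite K"
      by (rule finite_subset[of _ "{0..<int s} \<times> {0..int s}"]) (auto simp: K_def)
    have "card K \<le> card {0..int s}"
    proof (rule card_inj_on_le)
      show "inj_on snd K"
      proof (rule inj_onI)
        fix k k' assume k: "k \<in> K" "k' \<in> K" "snd k = snd k'"
        then have "int s dvd m - fst k' - snd k" "int s dvd m - fst k - snd k"
          by (auto simp: K_def)
        then have "int s dvd (m - fst k' - snd k) - (m - fst k - snd k)"
          by (rule dvd_diff)
        then have "fst k mod int s = fst k' mod int s"
          by (simp add: mod_eq_dvd_iff)
        then have "fst k = fst k'"
          using k(1,2) by (auto simp: K_def)
        then show "k = k'"
          using k(3) by (simp add: prod_eq_iff)
      qed
    qed (auto simp: K_def)
    then have cardK: "card K \<le> s + 1" by simp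
    \<comment> \<open>The second middle digit is recorded together with the carry from the first
      coordinates; the planar points are kept, so \<open>h\<close> is injective.\<close>
    define h where "h = (\<lambda>((P, c :: int), (Q, c')). ((c, c' + (fst P + fst Q) div int p), (P :: int \<times> int, Q :: int \<times> int)))"
    define reps' where "reps' = (\<lambda>(c, d). planar_reps p B z ((m - c - d) div int s))"
    have "card T \<le> card (Sigma K reps')"
    proof (rule card_inj_on_le)
      show "inj_on h T"
        by (rule inj_onI) (auto simp: h_def)
      show "h ` T \<subseteq> Sigma K reps'"
      proof
        fix w assume "w \<in> h ` T"
        then obtain x y c x' y' c' where mem: "(x, y) \<in> B" "(x', y') \<in> B" "c \<in> {0..<int s}" "c' \<in> {0..<int s}"
          and w: "w = h (((x, y), c), ((x', y'), c'))"
          and cong: "[unfold_plane p s ((x, y), c) + unfold_plane p s ((x', y'), c') = z] (mod int ?q)"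
          by (auto simp: T_def)
        define k where "k = (x + x') div int p"
        define Y where "Y = y + y'"
        \<comment> \<open>The digits are peeled off one by one: reduction mod p gives the first
          coordinate, division by p and reduction mod s the middle digits, and the quotient j the
          second coordinate.\<close>
        have Q: "int p * (int p * int s) dvd (x + x') + int p * (c + c' + int s * Y) - z"
          using cong by (simp add: unfold_plane_def cong_iff_dvd_diff Y_def algebra_simps)
        then have "int p dvd (x + x') + int p * (c + c' + int s * Y) - z"
          by (rule dvd_mult_left)
        then have "int p dvd ((x + x') + int p * (c + c' + int s * Y) - z) - int p * (c + c' + int s * Y)"
          by (rule dvd_diff) (rule dvd_triv_left)
        then have "int p dvd (x + x') - z"
          by (simp add: algebra_simps)
        then have X: "[x + x' = z] (mod int p)"
          by (simp add: cong_iff_dvd_diff)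
        have "x + x' = int p * k + z mod int p"
          using X mult_div_mod_eq[of "int p" "x + x'"] by (simp only: k_def cong_def)
        moreover have "z = int p * m + z mod int p"
          by (simp add: m_def)
        ultimately have "(x + x') + int p * (c + c' + int s * Y) - z = int p * (k + c + c' + int s * Y - m)"
          by (simp add: algebra_simps)
        with Q have dvd: "int p * int s dvd (k + c + c' + int s * Y - m)"
          using p by simp
        then have "int s dvd (k + c + c' + int s * Y - m)"
          by (rule dvd_mult_right)
        then have "int s dvd int s * Y - (k + c + c' + int s * Y - m)"
          by (rule dvd_diff[OF dvd_triv_left])
        then have s_dvd: "int s dvd m - c - (c' + k)"
          by (simp add: algebra_simps)
        then obtain j where j: "m - c - (c' + k) = int s * j"
          by (elim dvdE)
        have "k + c + c' + int s * Y - m = int s * (Y - j)"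
          using j by (simp add: algebra_simps)
        with dvd have "int p dvd Y - j"
          using s by (simp add: mult.commute[of "int p"])
        then have "[Y = (m - c - (c' + k)) div int s] (mod int p)"
          using s by (simp add: j cong_iff_dvd_diff)
        \<comment> \<open>Two residues add up to less than 2 p, so the carry k is 0 or 1 and c' + k
          stays within 0..s.\<close>
        moreover have "0 \<le> x" "0 \<le> x'" "x < int p" "x' < int p"
          using B mem by auto
        then have "0 \<le> x + x'" "x + x' < 2 * int p" by auto
        then have "0 \<le> k" "k < 2"
          using p pos_imp_zdiv_nonneg_iff[of "int p" "x + x'"]
            div_pos_geq[of "int p" "x + x'"] div_pos_pos_trivial[of "x + x'" "int p"]
            div_pos_pos_trivial[of "x + x' - int p" "int p"]
          unfolding k_def by (cases "x + x' < int p"; simp)+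
        ultimately show "w \<in> Sigma K reps'"
          using mem s_dvd X by (auto simp: w h_def K_def reps'_def planar_reps_def k_def Y_def)
      qed
      show "finite (Sigma K reps')"
        using finK finB by (auto simp: reps'_def finite_planar_reps)
    qed
    also have "\<dots> = (\<Sum>k\<in>K. card (reps' k))"
      using finK finB by (intro card_SigmaI) (auto simp: reps'_def finite_planar_reps)
    also have "\<dots> \<le> (\<Sum>k\<in>K. G)"
      by (intro sum_mono) (auto simp: reps'_def G)
    also have "\<dots> \<le> (s + 1) * G"
      using mult_le_mono1[OF cardK, of G] by simp
    finally show "card (reps (integer_mod_group ?q) A z) \<le> (s + 1) * G"
      using \<open>card (reps (integer_mod_group ?q) A z) \<le> card T\<close> by simp
  qed
  then show "Sidon (integer_mod_group ?q) ((s + 1) * G) A"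
    using sub by (simp add: Sidon_def)
qed

subsection \<open>Asymptotics\<close>

lemma Sidon_mono: "Sidon G g A \<Longrightarrow> g \<le> h \<Longrightarrow> Sidon G h A"
  unfolding Sidon_def using order_trans by blast

lemma max_Sidon_ge:
  assumes "q > 0" "Sidon (integer_mod_group q) g A"
  shows "card A \<le> max_Sidon g q"
  unfolding max_Sidon_def
  by (rule Max_ge[OF max_Sidon_attained(1)[OF assms(1)]]) (use assms(2) in blast)

lemma max_Sidon_ge_prime:
  assumes p: "prime p" "2 < p" "4 * m ^ 6 \<le> p" and m: "m \<ge> 1" and s: "s \<ge> 1"
    and g: "(real s + 1) * (real m ^ 6 + 204 * sqrt (real m ^ 9)) \<le> real g"
  shows "s * (m ^ 3 * (p - 1)) \<le> max_Sidon g (p * p * s)"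
proof -
  interpret odd_prime p
    by unfold_locales (use p in auto)
  obtain B where B: "B \<subseteq> R \<times> R" "m ^ 3 * (p - 1) \<le> card B"
    "\<And>a b. real (card (planar_reps p B a b)) \<le> real m ^ 6 + 204 * sqrt (real m ^ 9)"
    using ex_planar_set[OF m p(3)] by blast
  define G where "G = nat \<lfloor>real m ^ 6 + 204 * sqrt (real m ^ 9)\<rfloor>"
  define A where "A = unfold_plane p s ` (B \<times> {0..<int s})"
  have G: "card (planar_reps p B a b) \<le> G" for a b
    unfolding G_def by (rule le_nat_floor) (rule B(3))
  have ps: "0 < p" "0 < s" using p s by auto
  have A: "Sidon (integer_mod_group (p * p * s)) ((s + 1) * G) A" "card A = s * card B"
    unfolding A_def using Sidon_unfold_plane[OF ps B(1) G] by auto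
  have "real G \<le> real m ^ 6 + 204 * sqrt (real m ^ 9)"
    unfolding G_def by (rule of_nat_floor) simp
  then have "(real s + 1) * real G \<le> real g"
    by (intro order_trans[OF mult_left_mono g]) auto
  then have "real ((s + 1) * G) \<le> real g"
    by (simp add: algebra_simps)
  then have "(s + 1) * G \<le> g"
    by (simp only: of_nat_le_iff)
  then have "Sidon (integer_mod_group (p * p * s)) g A"
    using A(1) Sidon_mono by blast
  then have "s * card B \<le> max_Sidon g (p * p * s)"
    using max_Sidon_ge[of "p * p * s" g A] ps A(2) by simp
  moreover have "s * (m ^ 3 * (p - 1)) \<le> s * card B"
    using B(2) by (rule mult_le_mono2)
  ultimately show ?thesis by linarith
qed

text \<open>Along q = p^2 s the quotient is at least m^3 (sqrt s) (1 - 1/p), and p runs through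
  arbitrarily large primes.\<close>

lemma alpha_ge:
  assumes m: "m \<ge> 1" and s: "s \<ge> 1"
    and g: "(real s + 1) * (real m ^ 6 + 204 * sqrt (real m ^ 9)) \<le> real g"
  shows "real m ^ 3 * sqrt (real s) \<le> alpha g"
proof (rule ccontr)
  let ?L = "real m ^ 3 * sqrt (real s)"
  assume "\<not> ?L \<le> alpha g"
  then have "alpha g < ?L" by simp
  then obtain y where y: "alpha g < y" "y < ?L"
    using dense by blast
  have "limsup (\<lambda>q. ereal (real (max_Sidon g q) / sqrt (real q))) < ereal y"
    using y(1) unfolding alpha_ereal_def[symmetric] ereal_alpha[symmetric] by simp
  then have "eventually (\<lambda>q. ereal (real (max_Sidon g q) / sqrt (real q)) < ereal y) sequentially"
    by (rule Limsup_lessD)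
  then obtain N where N: "\<And>q. q \<ge> N \<Longrightarrow> real (max_Sidon g q) / sqrt (real q) < y"
    by (auto simp: eventually_sequentially)
  \<comment> \<open>With L the claimed bound, p >= L / (L - y) says that p y <= L (p - 1), so the
    loss of the factor 1 - 1/p still leaves at least y.\<close>
  obtain p where p: "prime p" "2 + 4 * m ^ 6 + N + nat \<lceil>?L / (?L - y)\<rceil> < p"
    using bigger_prime by blast
  have "real (nat \<lceil>?L / (?L - y)\<rceil>) \<le> real p"
    using p(2) unfolding of_nat_le_iff by linarith
  then have "?L / (?L - y) \<le> real p"
    by linarith
  then have "?L \<le> real p * (?L - y)"
    using y(2) by (simp add: divide_le_eq)
  then have py: "real p * y \<le> ?L * (real p - 1)"
    by (simp add: algebra_simps)
  have p0: "0 < p" using p(2) by simp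
  have "p * 1 \<le> p * (p * s)"
    using p0 s by (intro mult_le_mono2) simp
  then have "p \<le> p * p * s"
    by (simp only: mult.assoc mult_1_right)
  with p(2) have "N \<le> p * p * s"
    by linarith
  then have "real (max_Sidon g (p * p * s)) / sqrt (real (p * p * s)) < y"
    by (rule N)
  moreover have "sqrt (real (p * p * s)) = real p * sqrt (real s)"
    by (simp add: real_sqrt_mult)
  ultimately have "real (max_Sidon g (p * p * s)) < y * (real p * sqrt (real s))"
    using p0 s by (simp add: divide_less_eq)
  also have "\<dots> = (real p * y) * sqrt (real s)"
    by simp
  also have "\<dots> \<le> (?L * (real p - 1)) * sqrt (real s)"
    by (intro mult_right_mono py) simp
  also have "\<dots> = real (s * (m ^ 3 * (p - 1)))"
    using p0 by (simp add: of_nat_diff)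
  finally have "max_Sidon g (p * p * s) < s * (m ^ 3 * (p - 1))"
    by (simp only: of_nat_less_iff)
  moreover have "s * (m ^ 3 * (p - 1)) \<le> max_Sidon g (p * p * s)"
    using p(2) by (intro max_Sidon_ge_prime p(1) m s g) linarith+
  ultimately show False by linarith
qed

text \<open>Here b = g^(1/30) and u = sqrt m, which makes all exponents integral. The loss in u^12 s
  against b^30 is 612 b^24 from the error term of the planar set and 2 b^24 from rounding s.\<close>

lemma parameter_estimate:
  fixes b u s :: real
  assumes b: "b \<ge> 1" and u: "u > 0" "b ^ 4 / 2 \<le> u\<^sup>2" "u\<^sup>2 \<le> b ^ 4" and s: "s \<ge> 0"
    and Q: "b ^ 30 / (u ^ 12 + 204 * u ^ 9) - 2 \<le> s" "s \<le> b ^ 30 / (u ^ 12 + 204 * u ^ 9)"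
  shows "b ^ 15 - 614 * b ^ 9 \<le> u ^ 6 * sqrt s"
proof -
  let ?Q = "u ^ 12 + 204 * u ^ 9" and ?y = "u ^ 12 * s"
  have Qpos: "?Q > 0"
    using u(1) by (simp add: add_pos_pos)
  \<comment> \<open>The factor 1/3 replaces 1 / sqrt 8, since 1/9 <= 1/8.\<close>
  have "(b ^ 6 / 3)\<^sup>2 \<le> (b ^ 4 / 2) ^ 3"
    using b by (simp add: power2_eq_square power3_eq_cube flip: power_add)
  also have "\<dots> \<le> (u\<^sup>2) ^ 3"
    using b u(2) by (intro power_mono) auto
  also have "\<dots> = (u ^ 3)\<^sup>2"
    by (simp flip: power_mult)
  finally have u3: "b ^ 6 / 3 \<le> u ^ 3"
    by (rule power2_le_imp_le) (use u(1) in simp)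
  have "(u\<^sup>2) ^ 6 \<le> (b ^ 4) ^ 6"
    using u(3) by (intro power_mono) auto
  then have u12: "u ^ 12 \<le> b ^ 24"
    by (simp flip: power_mult)
  have "?y \<le> ?Q * s"
    using u(1) s by (intro mult_right_mono) auto
  also have "\<dots> \<le> b ^ 30"
    using Q(2) Qpos by (simp add: pos_le_divide_eq mult.commute)
  finally have y_le: "?y \<le> b ^ 30" .
  have "(1 - 204 / u ^ 3) * ?Q \<le> u ^ 12"
  proof -
    have "(1 - 204 / u ^ 3) * ?Q = u ^ 12 - 204\<^sup>2 * u ^ 6"
      using u(1) by (simp add: field_simps power2_eq_square flip: power_add)
    then show ?thesis using u(1) by simp
  qed
  \<comment> \<open>612 = 3 * 204, by the lower bound for u^3.\<close>
  moreover have "204 / u ^ 3 \<le> 612 / b ^ 6"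
    using u3 b u(1) by (simp add: field_simps)
  then have "(1 - 612 / b ^ 6) * ?Q \<le> (1 - 204 / u ^ 3) * ?Q"
    using Qpos by (intro mult_right_mono) auto
  ultimately have "(1 - 612 / b ^ 6) * ?Q \<le> u ^ 12"
    by (rule order_trans[rotated])
  then have "1 - 612 / b ^ 6 \<le> u ^ 12 / ?Q"
    using Qpos by (simp add: pos_le_divide_eq)
  then have "b ^ 30 * (1 - 612 / b ^ 6) \<le> b ^ 30 * (u ^ 12 / ?Q)"
    using b by (intro mult_left_mono) auto
  moreover have "b ^ 30 * (1 - 612 / b ^ 6) = b ^ 30 - 612 * b ^ 24"
    using b by (simp add: field_simps flip: power_add)
  moreover have "u ^ 12 * (b ^ 30 / ?Q - 2) \<le> ?y"
    using Q(1) u(1) by (intro mult_left_mono) auto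
  ultimately have "b ^ 30 - 612 * b ^ 24 - 2 * u ^ 12 \<le> ?y"
    by (simp add: algebra_simps)
  then have y_ge: "b ^ 30 - 614 * b ^ 24 \<le> ?y"
    using u12 by simp
  have sq: "sqrt ?y = u ^ 6 * sqrt s"
  proof -
    have "sqrt (u ^ 12) = u ^ 6"
      by (rule real_sqrt_unique) (use u(1) in \<open>auto simp flip: power_mult\<close>)
    then show ?thesis by (simp add: real_sqrt_mult)
  qed
  have "sqrt ?y \<le> b ^ 15"
    using y_le b by (intro real_le_lsqrt) (auto simp flip: power_mult)
  \<comment> \<open>As sqrt y <= b^15, also y <= b^15 sqrt y; cancelling b^15 turns the bound for y
    into one for sqrt y.\<close>
  have "b ^ 15 * (b ^ 15 - 614 * b ^ 9) \<le> ?y"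
    using y_ge by (simp add: algebra_simps flip: power_add)
  also have "\<dots> = sqrt ?y * sqrt ?y"
    using s u(1) by simp
  also have "\<dots> \<le> b ^ 15 * sqrt ?y"
    using \<open>sqrt ?y \<le> b ^ 15\<close> s u(1) by (intro mult_right_mono) auto
  finally show ?thesis
    using b by (simp add: sq)
qed

text \<open>The choice is m ~ g^(2/15), so that m^3 ~ g^(2/5), and s ~ g / m^6 ~ g^(1/5). Both
  relative losses are then of order g^(-1/5), which is g^(3/10) after multiplication by sqrt
  g.\<close>

lemma alpha_lower_bound:
  assumes "g \<ge> 1"
  shows "sqrt (real g) - 614 * real g powr (3 / 10) \<le> alpha g"
proof -
  define b where "b = real g powr (1 / 30)"
  have b: "b \<ge> 1"
    using assms by (simp add: b_def ge_one_powr_ge_zero)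
  have pow: "b ^ n = real g powr (real n / 30)" for n
    using assms by (simp add: b_def powr_powr flip: powr_realpow)
  have g: "real g = b ^ 30"
    using assms by (simp add: pow)
  have sq: "sqrt (real g) = b ^ 15"
    using assms by (simp add: pow powr_half_sqrt)
  have g9: "real g powr (3 / 10) = b ^ 9"
    by (simp add: pow)
  define m where "m = nat \<lfloor>b ^ 4\<rfloor>"
  have b4: "b ^ 4 \<ge> 1"
    using b by simp
  have m: "m \<ge> 1"
    using b4 by (simp add: m_def le_nat_floor)
  have m_le: "real m \<le> b ^ 4"
    unfolding m_def by (rule of_nat_floor) (use b in simp)
  have m_ge: "b ^ 4 / 2 \<le> real m"
  proof -
    have "b ^ 4 < real m + 1"
      using b by (simp add: m_def)
    then show ?thesis
      using m by linarith
  qed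
  define u where "u = sqrt (real m)"
  have u: "u > 0" "u\<^sup>2 = real m"
    using m by (auto simp: u_def)
  have um: "u ^ 12 = real m ^ 6" "u ^ 9 = sqrt (real m ^ 9)" "u ^ 6 = real m ^ 3"
  proof -
    show "u ^ 12 = real m ^ 6" "u ^ 6 = real m ^ 3"
      by (simp_all flip: u(2) power_mult)
    show "u ^ 9 = sqrt (real m ^ 9)"
      by (simp add: u_def real_sqrt_power)
  qed
  define r where "r = b ^ 30 / (u ^ 12 + 204 * u ^ 9)"
  have Qpos: "u ^ 12 + 204 * u ^ 9 > 0"
    using u(1) by (simp add: add_pos_pos)
  show ?thesis
  proof (cases "r \<ge> 2")
    case True
    \<comment> \<open>The largest s with s + 1 <= r, as the cyclic set has up to s + 1 times the
      planar number of representations; r >= 2 ensures s >= 1.\<close>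
    define s where "s = nat \<lfloor>r\<rfloor> - 1"
    have "2 \<le> nat \<lfloor>r\<rfloor>" using True by (intro le_nat_floor) simp
    moreover have "real (nat \<lfloor>r\<rfloor>) = real_of_int \<lfloor>r\<rfloor>" using True by simp
    ultimately have s: "s \<ge> 1" "real s = real_of_int \<lfloor>r\<rfloor> - 1"
      unfolding s_def by simp_all
    have "(real s + 1) * (u ^ 12 + 204 * u ^ 9) \<le> r * (u ^ 12 + 204 * u ^ 9)"
      using Qpos s(2) by (intro mult_right_mono) auto
    also have "\<dots> = real g"
      using Qpos by (simp add: r_def g)
    finally have "real m ^ 3 * sqrt (real s) \<le> alpha g"
      using alpha_ge[OF m s(1)] by (simp add: um)
    moreover have "b ^ 15 - 614 * b ^ 9 \<le> u ^ 6 * sqrt (real s)"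
    proof (rule parameter_estimate)
      show "b ^ 30 / (u ^ 12 + 204 * u ^ 9) - 2 \<le> real s"
        unfolding s(2) r_def[symmetric] by linarith
      show "real s \<le> b ^ 30 / (u ^ 12 + 204 * u ^ 9)"
        unfolding s(2) r_def[symmetric] by linarith
    qed (use b u m_ge m_le in auto)
    ultimately show ?thesis
      by (simp add: sq g9 um)
  next
    case False
    \<comment> \<open>For small r the bound is trivial: b^6 <= 410 = 2 * (1 + 204), so the error
      term alone exceeds sqrt g, and alpha is nonnegative.\<close>
    then have "b ^ 30 \<le> 2 * (u ^ 12 + 204 * u ^ 9)"
      using Qpos by (simp add: r_def field_simps)
    also have "u ^ 9 \<le> u ^ 12"
      using m by (intro power_increasing) (auto simp: u_def)
    then have "2 * (u ^ 12 + 204 * u ^ 9) \<le> 410 * u ^ 12"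
      by simp
    also have "u ^ 12 \<le> (b ^ 4) ^ 6"
      unfolding um by (intro power_mono m_le) simp
    finally have "b ^ 30 \<le> 410 * b ^ 24"
      by (simp flip: power_mult)
    also have "410 * b ^ 24 = b ^ 15 * (410 * b ^ 9)"
      by (subst mult.left_commute) (simp flip: power_add)
    finally have "b ^ 15 * b ^ 15 \<le> b ^ 15 * (410 * b ^ 9)"
      by (simp flip: power_add)
    then have "b ^ 15 \<le> 410 * b ^ 9"
      by (rule mult_left_le_imp_le) (use b in simp)
    moreover have "0 \<le> b ^ 9"
      using b by simp
    moreover have "0 \<le> alpha g"
      using alpha_ereal_finite(1)[of g] by (simp flip: ereal_alpha)
    ultimately show ?thesis
      unfolding sq g9 by linarith
  qed
qed

lemma alpha_le_sqrt: "alpha g \<le> sqrt (real g)"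
  using alpha_ereal_finite(2)[of g] by (simp flip: ereal_alpha)

theorem theorem2:
  shows "(\<lambda>g::nat. alpha g - sqrt (real g)) \<in> O(\<lambda>g. real g powr (3 / 10)) \<and>
    ((\<lambda>g::nat. alpha g / sqrt (real g)) \<longlonglongrightarrow> 1)"
proof
  have bound: "\<bar>alpha g - sqrt (real g)\<bar> \<le> 614 * real g powr (3 / 10)" if "g \<ge> 1" for g
    using alpha_lower_bound[OF that] alpha_le_sqrt[of g] by simp
  show "(\<lambda>g::nat. alpha g - sqrt (real g)) \<in> O(\<lambda>g. real g powr (3 / 10))"
    by (rule bigoI[of _ 614]) (use bound in \<open>auto simp: eventually_sequentially intro!: exI[of _ 1]\<close>)
  \<comment> \<open>The exponent -1/5 is 3/10 - 1/2, the error relative to sqrt g.\<close>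
  have lim: "(\<lambda>g. 1 - 614 * real g powr (- 1 / 5)) \<longlonglongrightarrow> 1"
    by real_asymp
  show "(\<lambda>g::nat. alpha g / sqrt (real g)) \<longlonglongrightarrow> 1"
  proof (rule tendsto_sandwich[OF _ _ lim tendsto_const])
    show "eventually (\<lambda>g. 1 - 614 * real g powr (- 1 / 5) \<le> alpha g / sqrt (real g)) sequentially"
    proof (rule eventually_sequentiallyI[of 1])
      fix g :: nat assume g: "g \<ge> 1"
      have "real g powr (- 1 / 5) * sqrt (real g) = real g powr (3 / 10)"
        using g by (simp flip: powr_half_sqrt powr_add)
      then have "(1 - 614 * real g powr (- 1 / 5)) * sqrt (real g) \<le> alpha g"
        using alpha_lower_bound[OF g] by (simp add: left_diff_distrib)
      then show "1 - 614 * real g powr (- 1 / 5) \<le> alpha g / sqrt (real g)"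
        using g by (simp add: pos_le_divide_eq)
    qed
    show "eventually (\<lambda>g. alpha g / sqrt (real g) \<le> 1) sequentially"
      by (rule eventually_sequentiallyI[of 1]) (simp add: alpha_le_sqrt)
  qed
qed

end
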